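(* Let $m\ge 0$ and $p,q\ge 1$ be integers, and let $(\alpha|\beta)$ be a partition (written in Frobenius coordinates) of length at most $p$ and with first part at most $q$. Then $$\dim F^{(p)}_{(\alpha+m|\beta)}\;\dim F^{(q)}_{(\beta+m|\alpha)}=\dim F^{(p+m)}_{(\alpha|\beta+m)}\;\dim F^{(q+m)}_{(\beta|\alpha+m)}.$$
   Context: A partition is a weakly decreasing finite sequence of nonnegative integers $\lambda=(\lambda_1,\lambda_2,\dots)$ (trailing zeros are ignored); its length $\ell(\lambda)$ is the number of nonzero parts, and $\lambda'$ is the conjugate partition. The Frobenius rank $r=\mathrm{rk}(\lambda)$ is the largest integer $k$ with $\lambda_k\ge k$ ($r=0$ for the empty partition). The Frobenius coordinates of $\lambda$ are $(\alpha|\beta)$, where $\alpha_i=\lambda_i-i$ and $\beta_i=\lambda'_i-i$ for $1\le i\le r$; thus $\alpha_1>\dots>\alpha_r\ge 0$ and $\beta_1>\dots>\beta_r\ge 0$, and conversely every such pair of strictly decreasing sequences of nonnegative integers of equal length determines a unique partition, denoted $(\alpha|\beta)$. For an integer $m\ge 0$, $\alpha+m$ denotes $(\alpha_1+m,\dots,\alpha_r+m)$. For a partition $\pi$ with $\ell(\pi)\le n$, $F^{(n)}_\pi$ denotes the finite-dimensional simple $\mathfrak{gl}_n$-module (over $\mathbb{C}$) with highest weight $\pi$. Its dimension equals the number of semistandard Young tableaux of shape $\pi$ with entries in $\{1,\dots,n\}$ (rows weakly increasing, columns strictly increasing), and is given by the hook content formula $\dim F^{(n)}_\pi=\prod_{u\in\pi}\frac{n+c(u)}{h(u)}$,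 where for a cell $u=(i,j)$ of the Young diagram of $\pi$, $c(u)=j-i$ is its content and $h(u)=\pi_i-i+\pi'_j-j+1$ is its hook length. *)

theory Defs
  imports Complex_Main "Jordan_Normal_Form.Matrix"
begin

section \<open>Partitions and Frobenius coordinates\<close>

text \<open>
  A partition is a function on \<open>nat\<close>, indexed from 0 and padded with zeros: the part
  \<open>\<lambda>\<^sub>i\<close> of the literature is \<open>lam (i - 1)\<close>.  Likewise \<open>conj_part lam j\<close>
  is the part \<open>\<lambda>'\<close> with index \<open>j + 1\<close>.
\<close>

definition is_partition :: "(nat \<Rightarrow> nat) \<Rightarrow> bool" where
  "is_partition lam \<longleftrightarrow> antimono lam \<and> finite {i. lam i \<noteq> 0}"

definition part_length :: "(nat \<Rightarrow> nat) \<Rightarrow> nat" where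
  "part_length lam = card {i. lam i \<noteq> 0}"

definition conj_part :: "(nat \<Rightarrow> nat) \<Rightarrow> nat \<Rightarrow> nat" where
  "conj_part lam j = card {i. j < lam i}"

definition frob_rank :: "(nat \<Rightarrow> nat) \<Rightarrow> nat" where
  "frob_rank lam = (GREATEST k. k = 0 \<or> k \<le> lam (k - 1))"

text \<open>
  The subtractions do not truncate for a partition: both \<open>lam i\<close> and \<open>conj_part lam i\<close>
  are at least the rank when \<open>i\<close> is below the rank.
\<close>

definition frob_coords :: "(nat \<Rightarrow> nat) \<Rightarrow> nat list \<times> nat list" where
  "frob_coords lam =
     (map (\<lambda>i. lam i - Suc i) [0..<frob_rank lam],
      map (\<lambda>i. conj_part lam i - Suc i) [0..<frob_rank lam])"

text \<open>The partition \<open>(\<alpha>|\<beta>)\<close>; see \<open>ex1_frob_coords\<close> for well-definedness.\<close>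

definition frob :: "nat list \<Rightarrow> nat list \<Rightarrow> nat \<Rightarrow> nat" where
  "frob \<alpha> \<beta> = (THE lam. is_partition lam \<and> frob_coords lam = (\<alpha>, \<beta>))"

lemma down_closed_card:
  assumes "finite (S :: nat set)" "\<And>i j. i \<le> j \<Longrightarrow> j \<in> S \<Longrightarrow> i \<in> S"
  shows "i \<in> S \<longleftrightarrow> i < card S"
proof -
  have "\<exists>k. S = {..<k}"
  proof (cases "S = {}")
    case True
    then show ?thesis by (intro exI[of _ 0]) simp
  next
    case False
    have "S = {..<Suc (Max S)}"
    proof (rule Set.set_eqI, rule iffI)
      fix x assume "x \<in> S"
      then show "x \<in> {..<Suc (Max S)}" using assms(1) by (simp add: less_Suc_eq_le)
    next
      fix x assume "x \<in> {..<Suc (Max S)}"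
      then show "x \<in> S" using assms(2)[of x "Max S"] Max_in[OF assms(1) False] by simp
    qed
    then show ?thesis by blast
  qed
  then show ?thesis by auto
qed

lemma less_conj_part_iff:
  assumes "is_partition lam"
  shows "i < conj_part lam j \<longleftrightarrow> j < lam i"
proof -
  have "finite {i. j < lam i}"
    by (rule finite_subset[of _ "{i. lam i \<noteq> 0}"]) (use assms in \<open>auto simp: is_partition_def\<close>)
  moreover have "a \<in> {i. j < lam i}" if "a \<le> b" "b \<in> {i. j < lam i}" for a b
    using that assms antimonoD[of lam a b] by (auto simp: is_partition_def)
  ultimately show ?thesis
    using down_closed_card[of "{i. j < lam i}" i] unfolding conj_part_def by blast
qed

lemma frob_rank_eqI:
  assumes "is_partition lam" "\<And>i. i < r \<Longrightarrow> r \<le> lam i" "lam r \<le> r"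
  shows "frob_rank lam = r"
  unfolding frob_rank_def
proof (rule Greatest_equality)
  show "r = 0 \<or> r \<le> lam (r - 1)" using assms(2)[of "r - 1"] by auto
  fix y assume y: "y = 0 \<or> y \<le> lam (y - 1)"
  show "y \<le> r"
  proof (rule ccontr)
    assume "\<not> y \<le> r"
    then have "r \<le> y - 1" "0 < y" by auto
    then have "lam (y - 1) \<le> lam r" using assms(1) antimonoD[of lam r "y - 1"]
      by (auto simp: is_partition_def)
    then show False using y assms(3) \<open>\<not> y \<le> r\<close> by auto
  qed
qed

lemma frob_rank_bounds:
  assumes "is_partition lam"
  shows "\<And>i. i < frob_rank lam \<Longrightarrow> frob_rank lam \<le> lam i" "lam (frob_rank lam) \<le> frob_rank lam"
proof -
  let ?P = "\<lambda>k. k = 0 \<or> k \<le> lam (k - 1)"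
  have bnd: "k \<le> lam 0" if "?P k" for k
    using that assms antimonoD[of lam 0 "k - 1"] by (auto simp: is_partition_def)
  have P: "?P (frob_rank lam)"
    unfolding frob_rank_def using GreatestI_nat[of ?P 0 "lam 0"] bnd by blast
  show "frob_rank lam \<le> lam i" if "i < frob_rank lam" for i
  proof -
    have "lam (frob_rank lam - 1) \<le> lam i"
      using that assms by (intro antimonoD[of lam]) (auto simp: is_partition_def)
    then show ?thesis using P that by linarith
  qed
  show "lam (frob_rank lam) \<le> frob_rank lam"
  proof (rule ccontr)
    assume "\<not> ?thesis"
    then have "?P (Suc (frob_rank lam))" by auto
    then have "Suc (frob_rank lam) \<le> frob_rank lam"
      unfolding frob_rank_def using Greatest_le_nat[of ?P _ "lam 0"] bnd by blast
    then show False by simp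
  qed
qed

lemma frob_coords_inj:
  assumes "is_partition lam" "is_partition mu" "frob_coords lam = frob_coords mu"
  shows "lam = mu"
proof
  fix i
  define r where "r = frob_rank lam"
  have r': "frob_rank mu = r"
    using arg_cong[OF assms(3), of "\<lambda>x. length (fst x)"] by (simp add: frob_coords_def r_def)
  note L = frob_rank_bounds[OF assms(1), folded r_def]
  note M = frob_rank_bounds[OF assms(2), unfolded r']
  have A: "lam k = mu k" if "k < r" for k
  proof -
    have "lam k - Suc k = mu k - Suc k"
      using assms(3) that by (auto simp: frob_coords_def r' r_def[symmetric])
    then show ?thesis using L(1)[OF that] M(1)[OF that] that by linarith
  qed
  have B: "conj_part lam k = conj_part mu k" if "k < r" for k
  proof -
    have *: "conj_part lam k - Suc k = conj_part mu k - Suc k"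
      using assms(3) that by (auto simp: frob_coords_def r' r_def[symmetric])
    have "r - 1 < conj_part lam k" "r - 1 < conj_part mu k"
      unfolding less_conj_part_iff[OF assms(1)] less_conj_part_iff[OF assms(2)]
      using that L(1)[of "r - 1"] M(1)[of "r - 1"] by auto
    then show ?thesis using * that by linarith
  qed
  show "lam i = mu i"
  proof (cases "i < r")
    case False
    then have "lam i \<le> r" "mu i \<le> r"
      using L(2) M(2) assms(1,2) antimonoD[of lam r i] antimonoD[of mu r i]
      by (auto simp: is_partition_def)
    moreover have "j < lam i \<longleftrightarrow> j < mu i" if "j < r" for j
      using B[OF that] less_conj_part_iff[OF assms(1), of i j]
        less_conj_part_iff[OF assms(2), of i j] by simp
    ultimately show ?thesis by (metis linorder_neqE_nat less_irrefl less_le_trans)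
  qed (use A in simp)
qed

lemma frob_coords_exist:
  assumes "sorted_wrt (>) \<alpha>" "sorted_wrt (>) \<beta>" "length \<alpha> = length \<beta>"
  shows "\<exists>lam. is_partition lam \<and> frob_coords lam = (\<alpha>, \<beta>)"
proof -
  define r where "r = length \<alpha>"
  have gap: "xs ! j + j \<le> xs ! i + i" if "sorted_wrt (>) xs" "i \<le> j" "j < length xs"
    for xs :: "nat list" and i j
    using that(2,3)
  proof (induction j rule: dec_induct)
    case (step k)
    then show ?case using sorted_wrt_nth_less[OF that(1), of k "Suc k"] by simp
  qed simp
  define S where "S i = {j. j < r \<and> i \<le> \<beta> ! j + j}" for i
  define lam where "lam i = (if i < r then \<alpha> ! i + Suc i else card (S i))" for i
  have finS: "finite (S i)" for i by (simp add: S_def)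
  have S_iff: "j \<in> S i \<longleftrightarrow> j < card (S i)" for i j
    by (rule down_closed_card[OF finS])
      (use gap[OF assms(2)] assms(3) in \<open>force simp: S_def r_def\<close>)
  have big: "r \<le> lam i" if "i < r" for i
  proof -
    have "i \<le> r - 1" "r - 1 < length \<alpha>" using that by (auto simp: r_def)
    from gap[OF assms(1) this] show ?thesis using that by (simp add: lam_def)
  qed
  have cardS: "card (S i) \<le> r" for i
    using card_mono[of "{..<r}" "S i"] by (auto simp: S_def)
  have anti: "lam j \<le> lam i" if "i \<le> j" for i j
  proof (cases "j < r")
    case True
    then show ?thesis using that gap[OF assms(1) that] by (simp add: lam_def r_def)
  next
    case j: False
    show ?thesis
    proof (cases "i < r")
      case True
      then show ?thesis using big[OF True] cardS[of j] j by (simp add: lam_def)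
    next
      case False
      have "card (S j) \<le> card (S i)"
        using that by (intro card_mono finS) (auto simp: S_def)
      then show ?thesis using False j by (simp add: lam_def)
    qed
  qed
  have fin: "finite {i. lam i \<noteq> 0}"
  proof (rule finite_subset)
    show "{i. lam i \<noteq> 0} \<subseteq> {..<r} \<union> {.. \<beta> ! 0}"
    proof
      fix i assume i: "i \<in> {i. lam i \<noteq> 0}"
      show "i \<in> {..<r} \<union> {.. \<beta> ! 0}"
      proof (cases "i < r")
        case False
        then have "0 \<in> S i" using i S_iff[of 0 i] by (simp add: lam_def)
        then show ?thesis by (simp add: S_def)
      qed simp
    qed
  qed simp
  have part: "is_partition lam"
    using anti fin by (auto simp: is_partition_def intro: antimonoI)
  have rank: "frob_rank lam = r"
    by (rule frob_rank_eqI[OF part big]) (use cardS in \<open>auto simp: lam_def\<close>)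
  have conj: "conj_part lam j = \<beta> ! j + Suc j" if "j < r" for j
  proof -
    have "j \<le> r - 1" "r - 1 < length \<beta>" using that assms(3) by (auto simp: r_def)
    from gap[OF assms(2) this] have "r - 1 \<le> \<beta> ! j + j" by simp
    then have "{i. j < lam i} = {..< \<beta> ! j + Suc j}"
      using big that S_iff[of j] by (force simp: lam_def S_def)
    then show ?thesis by (simp add: conj_part_def)
  qed
  have "frob_coords lam = (\<alpha>, \<beta>)"
    using assms(3) by (auto simp: frob_coords_def rank conj lam_def r_def intro!: nth_equalityI)
  then show ?thesis using part by blast
qed

lemma ex1_frob_coords:
  assumes "sorted_wrt (>) \<alpha>" "sorted_wrt (>) \<beta>" "length \<alpha> = length \<beta>"
  shows "\<exists>!lam. is_partition lam \<and> frob_coords lam = (\<alpha>, \<beta>)"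
  using frob_coords_exist[OF assms] frob_coords_inj by metis

section \<open>Simple highest weight modules of the general linear Lie algebra\<close>

definition matrix_unit :: "nat \<Rightarrow> nat \<Rightarrow> nat \<Rightarrow> complex mat" where
  "matrix_unit n i j = mat n n (\<lambda>(k, l). if k = i \<and> l = j then 1 else 0)"

text \<open>
  The Lie algebra is \<open>carrier_mat n n\<close> over the complex numbers with the commutator
  bracket; the underlying vector space of a module is a whole type.
\<close>

locale gl_module = vector_space scale
  for scale :: "complex \<Rightarrow> 'v::ab_group_add \<Rightarrow> 'v" +
  fixes n :: nat and act :: "complex mat \<Rightarrow> 'v \<Rightarrow> 'v"
  assumes act_linear: "X \<in> carrier_mat n n \<Longrightarrow> Vector_Spaces.linear scale scale (act X)"
    and act_add: "X \<in> carrier_mat n n \<Longrightarrow> Y \<in> carrier_mat n n \<Longrightarrow>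
      act (X + Y) v = act X v + act Y v"
    and act_smult: "X \<in> carrier_mat n n \<Longrightarrow> act (c \<cdot>\<^sub>m X) v = scale c (act X v)"
    and act_bracket: "X \<in> carrier_mat n n \<Longrightarrow> Y \<in> carrier_mat n n \<Longrightarrow>
      act (X * Y - Y * X) v = act X (act Y v) - act Y (act X v)"
begin

definition submodule :: "'v set \<Rightarrow> bool" where
  "submodule W \<longleftrightarrow> subspace W \<and> (\<forall>X \<in> carrier_mat n n. \<forall>w \<in> W. act X w \<in> W)"

definition has_highest_weight :: "(nat \<Rightarrow> nat) \<Rightarrow> bool" where
  "has_highest_weight \<pi> \<longleftrightarrow>
     (\<exists>v. v \<noteq> 0 \<and>
       (\<forall>i j. i < j \<and> j < n \<longrightarrow> act (matrix_unit n i j) v = 0) \<and>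
       (\<forall>i<n. act (matrix_unit n i i) v = scale (of_nat (\<pi> i)) v))"

end

locale fd_simple_gl_module = gl_module scale n act
  for scale :: "complex \<Rightarrow> 'v::ab_group_add \<Rightarrow> 'v" and n act +
  assumes finite_dim: "\<exists>B. finite B \<and> span B = UNIV"
    and nontrivial: "\<exists>v::'v. v \<noteq> 0"
    and simple: "submodule W \<Longrightarrow> W = {0} \<or> W = UNIV"

text \<open>
  \<open>is_F n \<pi> scale act\<close>: the module given by \<open>scale\<close> and \<open>act\<close> is (a model of)
  \<open>F\<close> with index \<open>\<pi>\<close> for the Lie algebra of size \<open>n\<close>, which is determined up to
  isomorphism.
\<close>

definition is_F ::
  "nat \<Rightarrow> (nat \<Rightarrow> nat) \<Rightarrow> (complex \<Rightarrow> 'v::ab_group_add \<Rightarrow> 'v) \<Rightarrow>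
    (complex mat \<Rightarrow> 'v \<Rightarrow> 'v) \<Rightarrow> bool" where
  "is_F n \<pi> scale act \<longleftrightarrow>
     fd_simple_gl_module scale n act \<and> gl_module.has_highest_weight scale n act \<pi>"

end

theory Submission
  imports Defs "Jordan_Normal_Form.Determinant" "HOL-Computational_Algebra.Polynomial"
    "HOL-Library.FuncSet"
begin

text \<open>
  The four modules are related only through their dimensions, so the proof computes the dimension
  of a simple highest weight module and then compares four products.

  The dimension is found by comparing an abstract simple module \<open>V\<close> of highest weight
  \<open>\<pi>\<close> with the Gelfand-Tsetlin model: the space of functions on the finite set of
  Gelfand-Tsetlin patterns with top row \<open>\<pi>\<close>, on which the Chevalley generators act by
  explicit rational coefficients.  The comparison rests on two properties of the model: the raising,
  lowering and diagonal operators have the right commutators (\<open>raise_lower_commutator\<close>,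
  \<open>diag_lower\<close>), and a vector that is annihilated by all raising operators is a multiple of the
  top pattern (\<open>raise_zero_imp_top\<close>).  The commutator of the two operators of the same index is a
  statement about the sum of the residues of a rational function (\<open>sum_residues\<close>).

  Given this, let \<open>graph\<close> be the linear relation between \<open>V\<close> and the model that is
  generated by the pair of highest weight vectors under the lowering operators.  By the commutation
  relations it is stable under all generators, so its kernels and images are stable subspaces.
  Simplicity of \<open>V\<close> and the absence of other singular vectors in the model and in its
  transpose force \<open>graph\<close> to be the graph of a linear bijection.  Hence the dimension is the
  number of patterns (\<open>dim_eq_card_gt_patterns\<close>).

  The patterns are counted row by row.  With the strictly increasing coordinates
  \<open>x i = \<pi> (n - 1 - i) + i\<close> the entries of the next row range independently over the
  intervals from \<open>x i\<close> to \<open>x (i + 1) - 1\<close>, and by multilinearity the sum of a determinant of binomial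
  coefficients over all these rows is the same determinant of one size more.  So the number of patterns
  is the product of \<open>(x j - x i) / (j - i)\<close> over \<open>i < j\<close>.

  In Frobenius coordinates the set of the \<open>x i\<close> is the union of \<open>n + \<alpha>\<close> and of the
  complement of \<open>\<beta>\<close> in \<open>{0..<n}\<close>, reflected.  This turns the product into
  \[ \frac{\Delta(\alpha) \Delta(\beta)}{\prod_{a, b} (a + b + 1)}
     \prod_{a} \frac{(a + n)!}{a!} \prod_{b} \frac{1}{b! (n - 1 - b)!}, \]
  where \<open>\<Delta>\<close> is the product of the differences, \<open>a\<close> runs over \<open>\<alpha>\<close> and
  \<open>b\<close> over \<open>\<beta>\<close> (\<open>card_gt_patterns_frob\<close>).  The first factor depends only on the
  differences inside \<open>\<alpha>\<close> and \<open>\<beta>\<close> and on the sums \<open>a + b\<close>, so it is the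
  same in all four modules of the theorem, and the factorials on the two sides agree after
  multiplication.
\<close>

section \<open>Determinants of binomial coefficients\<close>

lemma degree_linear_prod:
  fixes r :: "'i \<Rightarrow> 'a::field"
  assumes "finite I"
  shows "degree (\<Prod>i\<in>I. [:- r i, 1:]) = card I"
  using assms by (subst degree_prod_eq_sum_degree) auto

lemma lead_coeff_linear_prod:
  fixes r :: "'i \<Rightarrow> 'a::field"
  assumes "finite I"
  shows "coeff (\<Prod>i\<in>I. [:- r i, 1:]) (card I) = 1"
proof -
  have "lead_coeff (\<Prod>i\<in>I. [:- r i, 1:]) = 1" by (simp add: lead_coeff_prod)
  then show ?thesis by (simp add: degree_linear_prod[OF assms])
qed

lemma poly_linear_prod: "poly (\<Prod>i\<in>I. [:- r i, 1:]) t = (\<Prod>i\<in>I. t - r i)"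
  for r :: "'i \<Rightarrow> 'a::field"
  by (simp add: poly_prod algebra_simps)

definition binomial_poly :: "nat \<Rightarrow> real poly" where
  "binomial_poly j = smult (1 / fact j) (\<Prod>i<j. [:- real i, 1:])"

lemma poly_binomial_poly: "poly (binomial_poly j) t = t gchoose j"
  by (simp add: binomial_poly_def poly_linear_prod gbinomial_prod_rev atLeast0LessThan)

lemma degree_binomial_poly: "degree (binomial_poly j) = j"
  by (simp add: binomial_poly_def degree_linear_prod)

lemma lead_coeff_binomial_poly: "coeff (binomial_poly j) j = 1 / fact j"
  using lead_coeff_linear_prod[of "{..<j}" real] by (simp add: binomial_poly_def)

definition binomial_mat :: "nat \<Rightarrow> (nat \<Rightarrow> real) \<Rightarrow> real mat" where
  "binomial_mat n x = mat n n (\<lambda>(i, j). x i gchoose j)"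

text \<open>
  As a function of the last variable, the determinant is a polynomial of degree at most \<open>n\<close>
  that vanishes at the \<open>n\<close> other variables, and its leading coefficient is the determinant of one
  size less divided by \<open>fact n\<close>.
\<close>

lemma det_binomial_mat:
  assumes "inj_on x {..<n}"
  shows "det (binomial_mat n x) = (\<Prod>j<n. (\<Prod>i<j. x j - x i) / fact j)"
  using assms
proof (induction n)
  case 0
  then show ?case by (simp add: binomial_mat_def det_def)
next
  case (Suc n)
  let ?M = "binomial_mat (Suc n)"
  \<comment> \<open>\<open>q\<close> is the expansion of the determinant along the last row, with \<open>x n\<close> replaced by the indeterminate.\<close>
  define q where "q = (\<Sum>j<Suc n. smult (cofactor (?M x) n j) (binomial_poly j))"
  have carr: "?M y \<in> carrier_mat (Suc n) (Suc n)" for y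
    by (simp add: binomial_mat_def)
  have q_det: "poly q t = det (?M (x(n := t)))" for t
  proof -
    have "cofactor (?M (x(n := t))) n j = cofactor (?M x) n j" if "j < Suc n" for j
      unfolding cofactor_def mat_delete_def binomial_mat_def
      using that by (intro arg_cong2[of _ _ _ _ "\<lambda>x y. x * y"] arg_cong[of _ _ det]) auto
    then show ?thesis
      unfolding laplace_expansion_row[OF carr lessI]
      by (simp add: q_def poly_sum poly_binomial_poly binomial_mat_def mult.commute)
  qed
  have q_zero: "poly q (x i) = 0" if "i < n" for i
    unfolding q_det using that
    by (intro det_identical_rows[OF carr, of i n])
      (auto simp: binomial_mat_def intro!: eq_vecI)
  have q_deg: "degree q \<le> n"
    unfolding q_def by (intro degree_sum_le) (auto simp: degree_binomial_poly intro: order.trans[OF degree_smult_le])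
  have "mat_delete (?M x) n n = binomial_mat n x"
    by (auto simp: mat_delete_def binomial_mat_def)
  then have cof: "cofactor (?M x) n n = det (binomial_mat n x)"
    by (simp add: cofactor_def)
  have "coeff q n = (\<Sum>j<Suc n. if j = n then cofactor (?M x) n n / fact n else 0)"
    unfolding q_def coeff_sum
    by (intro sum.cong) (auto simp: lead_coeff_binomial_poly coeff_eq_0 degree_binomial_poly)
  then have q_lead: "coeff q n = det (binomial_mat n x) / fact n" by (simp add: cof)
  have inj: "inj_on x {..<n}" using Suc.prems by (auto simp: inj_on_def)
  have "q = smult (coeff q n) (\<Prod>i<n. [:- x i, 1:])"
  proof (rule poly_eqI_degree_lead_coeff[of _ n _ "x ` {..<n}"])
    show "card (x ` {..<n}) \<ge> n" by (simp add: card_image[OF inj])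
    show "poly q z = poly (smult (coeff q n) (\<Prod>i<n. [:- x i, 1:])) z" if "z \<in> x ` {..<n}" for z
      using that q_zero by (auto simp: poly_linear_prod)
  qed (use q_deg lead_coeff_linear_prod[of "{..<n}" x] in \<open>auto simp: degree_linear_prod\<close>)
  then have "poly q (x n) = poly (smult (coeff q n) (\<Prod>i<n. [:- x i, 1:])) (x n)"
    by (rule arg_cong)
  then show ?case
    unfolding q_det by (simp add: poly_linear_prod q_lead Suc.IH[OF inj])
qed

lemma sum_gchoose_telescope:
  fixes u v :: int
  assumes "u \<le> v"
  shows "(\<Sum>m\<in>{u..<v}. real_of_int m gchoose j) = (v gchoose Suc j) - (real_of_int u gchoose Suc j)"
  using assms
proof (induction v rule: int_ge_induct)
  case (step v)
  have "{u..<v + 1} = insert v {u..<v}" using step.hyps by auto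
  then show ?case using step.IH gbinomial_Suc_Suc[of "real_of_int v" j] by simp
qed simp

lemma sum_det_PiE:
  fixes g :: "'a \<Rightarrow> nat \<Rightarrow> 'b::comm_ring_1"
  assumes "\<And>i. i < n \<Longrightarrow> finite (S i)"
  shows "(\<Sum>y\<in>Pi\<^sub>E {..<n} S. det (mat n n (\<lambda>(i, j). g (y i) j))) =
    det (mat n n (\<lambda>(i, j). \<Sum>t\<in>S i. g t j))"
proof -
  have perm: "p i < n" if "p permutes {0..<n}" "i < n" for p i
    using that permutes_in_image[of p "{0..<n}" i] by simp
  have "(\<Sum>y\<in>Pi\<^sub>E {..<n} S. det (mat n n (\<lambda>(i, j). g (y i) j))) =
    (\<Sum>y\<in>Pi\<^sub>E {..<n} S. \<Sum>p | p permutes {0..<n}. signof p * (\<Prod>i<n. g (y i) (p i)))"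
    by (auto simp: det_def atLeast0LessThan perm intro!: sum.cong prod.cong)
  also have "\<dots> = (\<Sum>p | p permutes {0..<n}. signof p * (\<Sum>y\<in>Pi\<^sub>E {..<n} S. \<Prod>i<n. g (y i) (p i)))"
    by (subst sum.swap) (simp add: sum_distrib_left)
  also have "\<dots> = (\<Sum>p | p permutes {0..<n}. signof p * (\<Prod>i<n. \<Sum>t\<in>S i. g t (p i)))"
    by (intro sum.cong refl, subst prod_sum_PiE) (use assms in auto)
  also have "\<dots> = det (mat n n (\<lambda>(i, j). \<Sum>t\<in>S i. g t j))"
    by (auto simp: det_def atLeast0LessThan perm intro!: sum.cong prod.cong)
  finally show ?thesis .
qed

text \<open>
  Binomial coefficients telescope: summing column \<open>j\<close> over an interval gives a difference of
  column \<open>Suc j\<close> at the endpoints.  So the sum of the small determinants is the determinant of the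
  consecutive row differences of the large matrix.  Its first column is constant and thus contributes only
  the first row to the Laplace expansion.
\<close>

lemma sum_det_binomial_mat_interlacing:
  fixes x :: "nat \<Rightarrow> int"
  assumes "\<And>i. i < n \<Longrightarrow> x i \<le> x (Suc i)"
  shows "(\<Sum>y\<in>(\<Pi>\<^sub>E i\<in>{..<n}. {x i..<x (Suc i)}). det (binomial_mat n (\<lambda>i. y i))) =
    det (binomial_mat (Suc n) (\<lambda>i. x i))"
proof -
  let ?M = "binomial_mat (Suc n) (\<lambda>i. x i)"
  \<comment> \<open>Multiplication by \<open>L\<close> subtracts from each row the row above it.\<close>
  define L where "L = mat (Suc n) (Suc n) (\<lambda>(i, j). if i = j then 1 else if i = Suc j then - 1 else 0 :: real)"
  define D where "D = mat (Suc n) (Suc n) (\<lambda>(i, j). ?M $$ (i, j) - (if i = 0 then 0 else ?M $$ (i - 1, j)))"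
  have "L * ?M = D"
  proof (rule eq_matI)
    fix i j assume ij: "i < dim_row D" "j < dim_col D"
    then have i: "i < Suc n" and j: "j < Suc n" by (auto simp: D_def)
    have "(L * ?M) $$ (i, j) = (\<Sum>k<Suc n. L $$ (i, k) * ?M $$ (k, j))"
      using i j by (simp add: L_def binomial_mat_def scalar_prod_def atLeast0LessThan)
    also have "\<dots> = (\<Sum>k<Suc n. (if k = i then ?M $$ (i, j) else 0) -
        (if k = i - 1 then (if i = 0 then 0 else ?M $$ (i - 1, j)) else 0))"
      using i by (intro sum.cong) (auto simp: L_def)
    also have "\<dots> = D $$ (i, j)"
      using i j by (simp add: sum_subtractf D_def del: sum.lessThan_Suc)
    finally show "(L * ?M) $$ (i, j) = D $$ (i, j)" .
  qed (auto simp: L_def D_def binomial_mat_def)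
  moreover have "det L = 1"
    by (subst det_lower_triangular[of "Suc n"]) (auto simp: L_def prod_list_diag_prod)
  moreover have "det (L * ?M) = det L * det ?M"
    by (intro det_mult[of _ "Suc n"]) (auto simp: L_def binomial_mat_def)
  ultimately have "det ?M = det D" by simp
  also have "\<dots> = (\<Sum>i<Suc n. D $$ (i, 0) * cofactor D i 0)"
    by (intro laplace_expansion_column) (auto simp: D_def)
  also have "\<dots> = cofactor D 0 0 + (\<Sum>i<n. D $$ (Suc i, 0) * cofactor D (Suc i) 0)"
    by (subst sum.lessThan_Suc_shift) (simp add: D_def binomial_mat_def)
  also have "(\<Sum>i<n. D $$ (Suc i, 0) * cofactor D (Suc i) 0) = 0"
    by (intro sum.neutral) (simp add: D_def binomial_mat_def)
  also have "cofactor D 0 0 = det (mat_delete D 0 0)" by (simp add: cofactor_def)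
  also have "mat_delete D 0 0 = mat n n (\<lambda>(i, j). \<Sum>m\<in>{x i..<x (Suc i)}. real_of_int m gchoose j)"
    using assms
    by (intro eq_matI) (auto simp: mat_delete_def D_def binomial_mat_def sum_gchoose_telescope)
  finally show ?thesis
    unfolding binomial_mat_def by (subst sum_det_PiE) auto
qed

section \<open>Counting Gelfand-Tsetlin patterns\<close>

lemma strict_mono_onI_Suc:
  fixes x :: "nat \<Rightarrow> 'a::order"
  assumes "\<And>i. Suc i < n \<Longrightarrow> x i < x (Suc i)"
  shows "strict_mono_on {..<n} x"
proof (rule strict_mono_onI)
  fix i j assume "i \<in> {..<n}" "j \<in> {..<n}" "i < j"
  then show "x i < x j"
  proof (induction j)
    case (Suc j)
    then show ?case using assms[of j] by (cases "i = j") (auto intro: order.strict_trans)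
  qed simp
qed

text \<open>
  Row \<open>k\<close> has the entries \<open>(k, i)\<close> with \<open>i < k\<close>, and row \<open>n\<close> is \<open>x\<close>.
  Compared with the usual pattern of partitions, the row \<open>\<mu> 0 \<ge> \<dots> \<ge> \<mu> (k - 1)\<close>
  is stored in increasing order as \<open>\<Lambda> (k, i) = \<mu> (k - 1 - i) + i\<close>.  Then the interlacing
  conditions say that the entries of row \<open>k\<close> lie in consecutive half-open intervals.  Entries outside
  the triangle are \<open>0\<close>, so that patterns are determined by their rows.
\<close>

definition gt_patterns :: "nat \<Rightarrow> (nat \<Rightarrow> int) \<Rightarrow> (nat \<times> nat \<Rightarrow> int) set" where
  "gt_patterns n x = {\<Lambda>.
     (\<forall>k i. \<not> (i < k \<and> k \<le> n) \<longrightarrow> \<Lambda> (k, i) = 0) \<and>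
     (\<forall>i<n. \<Lambda> (n, i) = x i) \<and>
     (\<forall>k<n. \<forall>i<k. \<Lambda> (Suc k, i) \<le> \<Lambda> (k, i) \<and> \<Lambda> (k, i) < \<Lambda> (Suc k, Suc i))}"

lemma gt_patternsI:
  assumes "\<And>k i. \<not> (i < k \<and> k \<le> n) \<Longrightarrow> \<Lambda> (k, i) = 0"
    and "\<And>i. i < n \<Longrightarrow> \<Lambda> (n, i) = x i"
    and "\<And>k i. i < k \<Longrightarrow> k < n \<Longrightarrow> \<Lambda> (Suc k, i) \<le> \<Lambda> (k, i)"
    and "\<And>k i. i < k \<Longrightarrow> k < n \<Longrightarrow> \<Lambda> (k, i) < \<Lambda> (Suc k, Suc i)"
  shows "\<Lambda> \<in> gt_patterns n x"
  using assms unfolding gt_patterns_def by blast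

lemma gt_patternsD:
  assumes "\<Lambda> \<in> gt_patterns n x"
  shows "\<not> (i < k \<and> k \<le> n) \<Longrightarrow> \<Lambda> (k, i) = 0"
    and "i < n \<Longrightarrow> \<Lambda> (n, i) = x i"
    and "i < k \<Longrightarrow> k < n \<Longrightarrow> \<Lambda> (Suc k, i) \<le> \<Lambda> (k, i)"
    and "i < k \<Longrightarrow> k < n \<Longrightarrow> \<Lambda> (k, i) < \<Lambda> (Suc k, Suc i)"
  using assms unfolding gt_patterns_def by blast+

text \<open>
  A pattern is the same as its second row from the top together with the pattern below; the
  half-open intervals make the choices for the entries of that row independent of each other.
\<close>

lemma card_gt_patterns_Suc:
  fixes n x
  defines "Y \<equiv> \<Pi>\<^sub>E i\<in>{..<n}. {x i..<x (Suc i)}"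
  assumes fin: "\<And>y. y \<in> Y \<Longrightarrow> finite (gt_patterns n y)"
  shows "finite (gt_patterns (Suc n) x)"
    and "card (gt_patterns (Suc n) x) = (\<Sum>y\<in>Y. card (gt_patterns n y))"
proof -
  define ext where "ext \<Lambda> = (\<lambda>(k, i). if k = Suc n then if i < Suc n then x i else 0 else \<Lambda> (k, i))"
    for \<Lambda> :: "nat \<times> nat \<Rightarrow> int"
  define cut where "cut \<Lambda> = (\<lambda>(k, i). if k = Suc n then 0 else \<Lambda> (k, i))" for \<Lambda> :: "nat \<times> nat \<Rightarrow> int"
  define row where "row \<Lambda> = restrict (\<lambda>i. \<Lambda> (n, i)) {..<n}" for \<Lambda> :: "nat \<times> nat \<Rightarrow> int"
  let ?S = "SIGMA y:Y. gt_patterns n y"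
  have ext: "ext \<Lambda> \<in> gt_patterns (Suc n) x" "cut (ext \<Lambda>) = \<Lambda>" "row (ext \<Lambda>) = y"
    if y: "y \<in> Y" and \<Lambda>: "\<Lambda> \<in> gt_patterns n y" for y \<Lambda>
  proof -
    have yb: "x i \<le> y i \<and> y i < x (Suc i)" if "i < n" for i
      using PiE_mem[OF y[unfolded Y_def], of i] that by simp
    note D = gt_patternsD[OF \<Lambda>]
    show "ext \<Lambda> \<in> gt_patterns (Suc n) x"
    proof (rule gt_patternsI)
      fix k i assume ik: "i < k" "k < Suc n"
      show "ext \<Lambda> (Suc k, i) \<le> ext \<Lambda> (k, i)" "ext \<Lambda> (k, i) < ext \<Lambda> (Suc k, Suc i)"
        using D(2)[of i] D(3,4)[of i k] yb[of i] ik by (cases "k = n"; simp add: ext_def)+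
    qed (use D(1) in \<open>auto simp: ext_def\<close>)
    show "cut (ext \<Lambda>) = \<Lambda>"
      using D(1) by (auto simp: cut_def ext_def fun_eq_iff)
    show "row (ext \<Lambda>) = y"
      using D(2) PiE_arb[OF y[unfolded Y_def]] by (auto simp: row_def ext_def fun_eq_iff)
  qed
  have cut: "row \<Lambda> \<in> Y" "cut \<Lambda> \<in> gt_patterns n (row \<Lambda>)" "ext (cut \<Lambda>) = \<Lambda>"
    if \<Lambda>: "\<Lambda> \<in> gt_patterns (Suc n) x" for \<Lambda>
  proof -
    note D = gt_patternsD[OF \<Lambda>]
    show "row \<Lambda> \<in> Y"
      unfolding Y_def row_def
    proof (rule restrict_PiE_iff[THEN iffD2], rule ballI)
      fix i assume "i \<in> {..<n}"
      then show "\<Lambda> (n, i) \<in> {x i..<x (Suc i)}"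
        using D(2)[of i] D(2)[of "Suc i"] D(3,4)[of i n] by simp
    qed
    show "cut \<Lambda> \<in> gt_patterns n (row \<Lambda>)"
      by (rule gt_patternsI) (use D in \<open>auto simp: cut_def row_def\<close>)
    show "ext (cut \<Lambda>) = \<Lambda>"
      using D(1,2) by (auto simp: cut_def ext_def fun_eq_iff)
  qed
  have bij: "bij_betw (\<lambda>(y, \<Lambda>). ext \<Lambda>) ?S (gt_patterns (Suc n) x)"
    by (rule bij_betw_byWitness[where f' = "\<lambda>\<Lambda>. (row \<Lambda>, cut \<Lambda>)"]) (use ext cut in auto)
  have finY: "finite Y" unfolding Y_def by (intro finite_PiE) auto
  show "finite (gt_patterns (Suc n) x)"
    using bij_betw_finite[OF bij] finY fin by auto
  show "card (gt_patterns (Suc n) x) = (\<Sum>y\<in>Y. card (gt_patterns n y))"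
    using finY fin by (simp flip: bij_betw_same_card[OF bij])
qed

lemma card_gt_patterns_det:
  assumes "\<And>i. Suc i < n \<Longrightarrow> x i < x (Suc i)"
  shows "finite (gt_patterns n x) \<and> real (card (gt_patterns n x)) = det (binomial_mat n (\<lambda>i. x i))"
  using assms
proof (induction n arbitrary: x)
  case 0
  have "gt_patterns 0 x = {\<lambda>_. 0}" by (auto simp: gt_patterns_def)
  then show ?case by (simp add: binomial_mat_def det_def)
next
  case (Suc n)
  let ?Y = "\<Pi>\<^sub>E i\<in>{..<n}. {x i..<x (Suc i)}"
  have IH: "finite (gt_patterns n y)" "real (card (gt_patterns n y)) = det (binomial_mat n (\<lambda>i. y i))"
    if "y \<in> ?Y" for y
  proof -
    have "y i < y (Suc i)" if "Suc i < n" for i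
      using PiE_mem[OF \<open>y \<in> ?Y\<close>, of i] PiE_mem[OF \<open>y \<in> ?Y\<close>, of "Suc i"] that by auto
    with Suc.IH[of y] show "finite (gt_patterns n y)"
      "real (card (gt_patterns n y)) = det (binomial_mat n (\<lambda>i. y i))" by auto
  qed
  note step = card_gt_patterns_Suc[where n = n and x = x, OF IH(1)]
  have "real (card (gt_patterns (Suc n) x)) = (\<Sum>y\<in>?Y. det (binomial_mat n (\<lambda>i. y i)))"
    using IH step(2) by simp
  also have "\<dots> = det (binomial_mat (Suc n) (\<lambda>i. x i))"
    using Suc.prems by (intro sum_det_binomial_mat_interlacing) (simp add: less_imp_le)
  finally show ?case using step(1) by simp
qed

lemma card_gt_patterns:
  assumes "\<And>i. Suc i < n \<Longrightarrow> x i < x (Suc i)"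
  shows "real (card (gt_patterns n x)) = (\<Prod>j<n. (\<Prod>i<j. real_of_int (x j - x i)) / fact j)"
proof -
  have "inj_on (\<lambda>i. real_of_int (x i)) {..<n}"
    using strict_mono_on_imp_inj_on[OF strict_mono_onI_Suc[of n x, OF assms]] by (auto simp: inj_on_def)
  then show ?thesis using card_gt_patterns_det[of n x] assms by (simp add: det_binomial_mat)
qed

section \<open>A residue identity\<close>

lemma second_coeff_linear_prod:
  fixes r :: "'i \<Rightarrow> 'a::field"
  assumes "finite I" "I \<noteq> {}"
  shows "coeff (\<Prod>i\<in>I. [:- r i, 1:]) (card I - 1) = - (\<Sum>i\<in>I. r i)"
  using assms
proof (induction I rule: finite_ne_induct)
  case (insert i I)
  then obtain m where m: "card I = Suc m" by (metis card_eq_0_iff not0_implies_Suc)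
  show ?case
    using insert lead_coeff_linear_prod[of I r] by (simp add: m)
qed simp

text \<open>
  Compare the second highest coefficients in the Lagrange interpolation at \<open>S\<close> of the polynomial
  with roots \<open>r i\<close> minus the polynomial with roots \<open>S\<close>: both are monic of the same degree,
  so the difference is interpolated exactly.
\<close>

lemma sum_residues_simple_poles:
  fixes r :: "'i \<Rightarrow> 'a::field"
  assumes "finite S" "finite I" "card I = card S"
  shows "(\<Sum>s\<in>S. (\<Prod>i\<in>I. s - r i) / (\<Prod>t\<in>S - {s}. s - t)) = \<Sum>S - (\<Sum>i\<in>I. r i)"
proof (cases "S = {}")
  case True
  then show ?thesis using assms by simp
next
  case False
  then have I: "I \<noteq> {}" using assms by (metis card.empty card_0_eq)
  obtain m where m: "card S = Suc m" using False assms by (metis card_eq_0_iff not0_implies_Suc)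
  define P where "P = (\<Prod>i\<in>I. [:- r i, 1:])"
  define Q where "Q = (\<Prod>s\<in>S. [:- s, 1:])"
  define c where "c s = (\<Prod>i\<in>I. s - r i) / (\<Prod>t\<in>S - {s}. s - t)" for s
  define L where "L = (\<Sum>s\<in>S. smult (c s) (\<Prod>t\<in>S - {s}. [:- t, 1:]))"
  have card': "card (S - {s}) = m" if "s \<in> S" for s using that m assms by simp
  have degL: "degree L \<le> m"
    unfolding L_def using assms(1)
    by (intro degree_sum_le) (auto simp: degree_linear_prod m intro: order.trans[OF degree_smult_le])
  have "P = Q + L"
  proof (rule poly_eqI_degree_lead_coeff[of _ "Suc m" _ S])
    have "coeff L (Suc m) = 0" using degL by (intro coeff_eq_0) simp
    then show "coeff P (Suc m) = coeff (Q + L) (Suc m)"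
      using lead_coeff_linear_prod[OF assms(2), of r] lead_coeff_linear_prod[OF assms(1), of "\<lambda>s. s"] assms(3) m
      by (simp add: P_def Q_def)
    show "degree P \<le> Suc m" using assms m by (simp add: P_def degree_linear_prod)
    show "degree (Q + L) \<le> Suc m"
      using degL assms m by (intro degree_add_le) (auto simp: Q_def degree_linear_prod[of _ "\<lambda>s. s"])
    fix s assume s: "s \<in> S"
    have "poly L s = (\<Sum>u\<in>S. if u = s then c s * (\<Prod>t\<in>S - {s}. s - t) else 0)"
      unfolding L_def poly_sum using assms(1) s
      by (intro sum.cong) (auto simp: poly_linear_prod[of "\<lambda>s. s"] intro: prod_zero)
    also have "\<dots> = (\<Prod>i\<in>I. s - r i)"
      using assms(1) s by (simp add: c_def)
    finally have "poly L s = poly P s" by (simp add: P_def poly_linear_prod)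
    moreover have "poly Q s = 0"
      unfolding Q_def using assms(1) s by (auto simp: poly_linear_prod[of "\<lambda>s. s"] intro: prod_zero)
    ultimately show "poly P s = poly (Q + L) s" by simp
  qed (use m in simp)
  then have "coeff P m = coeff Q m + coeff L m" by simp
  moreover have "coeff P m = - (\<Sum>i\<in>I. r i)"
    using second_coeff_linear_prod[OF assms(2) I, of r] assms(3) m by (simp add: P_def)
  moreover have "coeff Q m = - \<Sum>S"
    using second_coeff_linear_prod[OF assms(1) False, of "\<lambda>s. s"] m by (simp add: Q_def)
  moreover have "coeff L m = (\<Sum>s\<in>S. c s)"
    unfolding L_def coeff_sum
  proof (intro sum.cong refl)
    fix s assume s: "s \<in> S"
    show "coeff (smult (c s) (\<Prod>t\<in>S - {s}. [:- t, 1:])) m = c s"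
      using lead_coeff_linear_prod[of "S - {s}" "\<lambda>s. s"] assms(1) card'[OF s] by simp
  qed
  ultimately show ?thesis unfolding c_def by (simp add: algebra_simps)
qed

text \<open>
  The function \<open>g\<close> gives the residues of the rational function with zeros \<open>Y\<close> and \<open>Z\<close> and
  poles \<open>X\<close> and \<open>X'\<close> at its simple poles.  A common element of \<open>X\<close> and \<open>X'\<close> is a
  zero of both factors of the numerator, so there the double pole cancels and no residue is left.  In the
  application, \<open>X'\<close> is \<open>X\<close> shifted by one, and the common elements come from equal neighbouring parts.
\<close>

lemma sum_residues:
  fixes X X' Y Z :: "'a::field set"
  assumes fin: "finite X" "finite X'" "finite Y" "finite Z"
    and card: "card Y + card Z = card X + card X'"
    and common: "X \<inter> X' \<subseteq> Y \<inter> Z"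
  defines "g \<equiv> \<lambda>s. (\<Prod>y\<in>Y. s - y) * (\<Prod>z\<in>Z. s - z) / ((\<Prod>x\<in>X - {s}. s - x) * (\<Prod>x\<in>X' - {s}. s - x))"
  shows "(\<Sum>s\<in>X - X'. g s) + (\<Sum>s\<in>X' - X. g s) = \<Sum>X + \<Sum>X' - \<Sum>Y - \<Sum>Z"
proof -
  define T where "T = X \<inter> X'"
  define S where "S = (X - X') \<union> (X' - X)"
  define I where "I = (Y - T) <+> (Z - T)"
  define r :: "'a + 'a \<Rightarrow> 'a" where "r = case_sum id id"
  have finT: "finite T" and finS: "finite S" and finI: "finite I"
    using fin by (auto simp: T_def S_def I_def)
  have T: "T \<subseteq> X" "T \<subseteq> X'" "T \<subseteq> Y" "T \<subseteq> Z" using common by (auto simp: T_def)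
  have split_sum: "\<Sum>A = \<Sum>(A - T) + \<Sum>T" if "finite A" "T \<subseteq> A" for A
    using that by (simp add: sum.subset_diff[of T A] add.commute)
  have split_prod: "(\<Prod>a\<in>A. s - a) = (\<Prod>a\<in>A - T. s - a) * (\<Prod>a\<in>T. s - a)" if "finite A" "T \<subseteq> A" for A s
    using that by (simp add: prod.subset_diff[of T A])
  have cardI: "card I = card S"
  proof -
    have "card I = card Y - card T + (card Z - card T)"
      using fin T finT by (simp add: I_def card_Plus card_Diff_subset)
    moreover have "card S = card (X - T) + card (X' - T)"
      unfolding S_def using fin by (subst card_Un_disjoint) (auto simp: T_def intro!: arg_cong2[of _ _ _ _ "(+)"] arg_cong[of _ _ card])
    moreover have "card T \<le> card A" if "finite A" "T \<subseteq> A" for A using that by (rule card_mono)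
    ultimately show ?thesis
      using card fin T finT by (simp add: card_Diff_subset)
  qed
  \<comment> \<open>Removing the common elements from numerator and denominator cancels the factor \<open>?\<tau>\<close> twice.\<close>
  have simple: "g s = (\<Prod>i\<in>I. s - r i) / (\<Prod>t\<in>S - {s}. s - t)" if s: "s \<in> S" for s
  proof -
    let ?\<tau> = "\<Prod>t\<in>T. s - t"
    have sT: "s \<notin> T" using s by (auto simp: S_def T_def)
    then have \<tau>: "?\<tau> \<noteq> 0" using finT by auto
    have num: "(\<Prod>i\<in>I. s - r i) = (\<Prod>y\<in>Y - T. s - y) * (\<Prod>z\<in>Z - T. s - z)"
      unfolding I_def r_def using fin by (subst prod.Plus) auto
    have "S - {s} = (X - {s} - T) \<union> (X' - {s} - T)" by (auto simp: S_def T_def)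
    moreover have "(X - {s} - T) \<inter> (X' - {s} - T) = {}" by (auto simp: T_def)
    ultimately have den: "(\<Prod>t\<in>S - {s}. s - t) = (\<Prod>t\<in>X - {s} - T. s - t) * (\<Prod>t\<in>X' - {s} - T. s - t)"
      using fin by (simp add: prod.union_disjoint)
    have sub: "T \<subseteq> X - {s}" "T \<subseteq> X' - {s}" using T sT by auto
    have "g s = ((\<Prod>i\<in>I. s - r i) * (?\<tau> * ?\<tau>)) / ((\<Prod>t\<in>S - {s}. s - t) * (?\<tau> * ?\<tau>))"
      unfolding g_def num den using fin T sub
      by (simp add: split_prod[of Y] split_prod[of Z] split_prod[of "X - {s}"] split_prod[of "X' - {s}"] ac_simps)
    then show ?thesis using \<tau> by simp
  qed
  have "(\<Sum>s\<in>X - X'. g s) + (\<Sum>s\<in>X' - X. g s) = (\<Sum>s\<in>S. g s)"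
    unfolding S_def using fin by (subst sum.union_disjoint) auto
  also have "\<dots> = \<Sum>S - (\<Sum>i\<in>I. r i)"
    using sum_residues_simple_poles[OF finS finI cardI] by (simp add: simple)
  also have "(\<Sum>i\<in>I. r i) = \<Sum>(Y - T) + \<Sum>(Z - T)"
    unfolding I_def r_def using fin by (subst sum.Plus) (auto simp: id_def)
  also have "\<Sum>S = \<Sum>(X - T) + \<Sum>(X' - T)"
    unfolding S_def using fin by (subst sum.union_disjoint) (auto simp: T_def intro!: arg_cong2[of _ _ _ _ "(+)"] sum.cong)
  finally show ?thesis
    using split_sum[of X] split_sum[of X'] split_sum[of Y] split_sum[of Z] fin T by simp
qed

section \<open>Matrix coefficients on Gelfand-Tsetlin patterns\<close>

definition bump :: "(nat \<times> nat \<Rightarrow> int) \<Rightarrow> nat \<Rightarrow> nat \<Rightarrow> nat \<times> nat \<Rightarrow> int" where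
  "bump \<Lambda> k i = \<Lambda>((k, i) := \<Lambda> (k, i) + 1)"

definition drop_at :: "(nat \<times> nat \<Rightarrow> int) \<Rightarrow> nat \<Rightarrow> nat \<Rightarrow> nat \<times> nat \<Rightarrow> int" where
  "drop_at \<Lambda> k i = \<Lambda>((k, i) := \<Lambda> (k, i) - 1)"

lemma bump_drop_at [simp]: "bump (drop_at \<Lambda> k i) k i = \<Lambda>" "drop_at (bump \<Lambda> k i) k i = \<Lambda>"
  by (auto simp: bump_def drop_at_def)

lemma bump_drop_at_commute:
  "(k, i) \<noteq> (l, j) \<Longrightarrow> bump (drop_at \<Lambda> k i) l j = drop_at (bump \<Lambda> l j) k i"
  by (auto simp: bump_def drop_at_def fun_eq_iff)

text \<open>
  The coefficients of the Gelfand-Tsetlin action in a normalisation without square roots.  Both are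
  indexed by the lower end \<open>\<Lambda>\<close> of the edge from \<open>\<Lambda>\<close> to \<open>bump \<Lambda> (Suc k) i\<close>: the
  raising coefficient involves, apart from the changed row, only the row above it, and the lowering
  coefficient only the row below it.
\<close>

definition up_coef :: "nat \<Rightarrow> nat \<Rightarrow> (nat \<times> nat \<Rightarrow> int) \<Rightarrow> complex" where
  "up_coef k i \<Lambda> =
     (\<Prod>j<Suc (Suc k). of_int (\<Lambda> (Suc k, i) + 1 - \<Lambda> (Suc (Suc k), j))) /
     (\<Prod>j\<in>{..k} - {i}. of_int (\<Lambda> (Suc k, i) - \<Lambda> (Suc k, j)))"

definition down_coef :: "nat \<Rightarrow> nat \<Rightarrow> (nat \<times> nat \<Rightarrow> int) \<Rightarrow> complex" where
  "down_coef k i \<Lambda> =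
     - (\<Prod>j<k. of_int (\<Lambda> (Suc k, i) - \<Lambda> (k, j))) /
     (\<Prod>j\<in>{..k} - {i}. of_int (\<Lambda> (Suc k, i) + 1 - \<Lambda> (Suc k, j)))"

text \<open>
  This makes the two paths around a square of one raising and one lowering step at different places
  contribute equally.  The coefficients interact only when they change the same row or when the lowering
  step is in the next row; then two factors are exchanged up to a shift by one.
\<close>

lemma up_down_coef_square:
  assumes "(k, i) \<noteq> (l, j)" "i \<le> k" "j \<le> l"
  shows "up_coef k i \<Lambda> * down_coef l j \<Lambda> =
    down_coef l j (bump \<Lambda> (Suc k) i) * up_coef k i (bump \<Lambda> (Suc l) j)"
proof -
  consider "l = k" | "l = Suc k" | "l \<noteq> k" "l \<noteq> Suc k" by blast
  then show ?thesis
  proof cases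
    case 1
    then have ij: "i \<noteq> j" "i \<le> k" "j \<le> k" using assms by auto
    define u where "u = (\<Prod>a<Suc (Suc k). of_int (\<Lambda> (Suc k, i) + 1 - \<Lambda> (Suc (Suc k), a)) :: complex)"
    define v where "v = (\<Prod>a<k. of_int (\<Lambda> (Suc k, j) - \<Lambda> (k, a)) :: complex)"
    define d where "d = (\<Prod>a\<in>{..k} - {i} - {j}. of_int (\<Lambda> (Suc k, i) - \<Lambda> (Suc k, a)) :: complex)"
    define e where "e = (\<Prod>a\<in>{..k} - {i} - {j}. of_int (\<Lambda> (Suc k, j) + 1 - \<Lambda> (Suc k, a)) :: complex)"
    define p where "p = (of_int (\<Lambda> (Suc k, i)) :: complex)"
    define q where "q = (of_int (\<Lambda> (Suc k, j)) :: complex)"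
    have comm: "{..k} - {j} - {i} = {..k} - {i} - {j}" by auto
    have "up_coef k i \<Lambda> = u / ((p - q) * d)"
      unfolding up_coef_def using ij
      by (subst prod.remove[of "{..k} - {i}" j]) (auto simp: u_def d_def p_def q_def)
    moreover have "down_coef k j \<Lambda> = - v / ((q + 1 - p) * e)"
      unfolding down_coef_def using ij
      by (subst prod.remove[of "{..k} - {j}" i]) (auto simp: v_def e_def p_def q_def comm)
    moreover have "up_coef k i (bump \<Lambda> (Suc k) j) = u / ((p - q - 1) * d)"
      unfolding up_coef_def using ij
      by (subst prod.remove[of "{..k} - {i}" j])
        (auto simp: bump_def u_def d_def p_def q_def algebra_simps)
    moreover have "down_coef k j (bump \<Lambda> (Suc k) i) = - v / ((q - p) * e)"
      unfolding down_coef_def using ij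
      by (subst prod.remove[of "{..k} - {j}" i])
        (auto simp: bump_def v_def e_def p_def q_def comm)
    moreover have "(p - q) * d * ((q + 1 - p) * e) = (q - p) * e * ((p - q - 1) * d)"
      by (simp add: algebra_simps)
    ultimately show ?thesis using 1 by (simp only: times_divide_times_eq) (simp only: mult.commute[of u])
  next
    case 2
    define u where "u = (\<Prod>a\<in>{..<Suc (Suc k)} - {j}. of_int (\<Lambda> (Suc k, i) + 1 - \<Lambda> (Suc (Suc k), a)) :: complex)"
    define v where "v = (\<Prod>a\<in>{..<Suc k} - {i}. of_int (\<Lambda> (Suc (Suc k), j) - \<Lambda> (Suc k, a)) :: complex)"
    define d where "d = (\<Prod>a\<in>{..k} - {i}. of_int (\<Lambda> (Suc k, i) - \<Lambda> (Suc k, a)) :: complex)"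
    define e where "e = (\<Prod>a\<in>{..Suc k} - {j}. of_int (\<Lambda> (Suc (Suc k), j) + 1 - \<Lambda> (Suc (Suc k), a)) :: complex)"
    define p where "p = (of_int (\<Lambda> (Suc k, i)) :: complex)"
    define q where "q = (of_int (\<Lambda> (Suc (Suc k), j)) :: complex)"
    have ij: "i < Suc k" "j < Suc (Suc k)" using assms 2 by auto
    have "up_coef k i \<Lambda> = (p + 1 - q) * u / d"
      unfolding up_coef_def using ij
      by (subst prod.remove[of _ j]) (auto simp: u_def d_def p_def q_def simp del: prod.lessThan_Suc)
    moreover have "down_coef (Suc k) j \<Lambda> = - ((q - p) * v) / e"
      unfolding down_coef_def using ij
      by (subst prod.remove[of _ i]) (auto simp: v_def e_def p_def q_def simp del: prod.lessThan_Suc)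
    moreover have "up_coef k i (bump \<Lambda> (Suc (Suc k)) j) = (p - q) * u / d"
      unfolding up_coef_def using ij
      by (subst prod.remove[of _ j]) (auto simp: bump_def u_def d_def p_def q_def simp del: prod.lessThan_Suc)
    moreover have "down_coef (Suc k) j (bump \<Lambda> (Suc k) i) = - ((q - p - 1) * v) / e"
      unfolding down_coef_def using ij
      by (subst prod.remove[of _ i]) (auto simp: bump_def v_def e_def p_def q_def algebra_simps simp del: prod.lessThan_Suc)
    ultimately show ?thesis using 2 by (simp add: algebra_simps)
  next
    case 3
    then have "up_coef k i (bump \<Lambda> (Suc l) j) = up_coef k i \<Lambda>"
      "down_coef l j (bump \<Lambda> (Suc k) i) = down_coef l j \<Lambda>"
      by (simp_all add: up_coef_def down_coef_def bump_def)
    then show ?thesis by simp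
  qed
qed

locale gelfand_tsetlin =
  fixes n :: nat and x :: "nat \<Rightarrow> int"
  assumes x_strict: "Suc i < n \<Longrightarrow> x i < x (Suc i)"
begin

abbreviation P :: "(nat \<times> nat \<Rightarrow> int) set" where
  "P \<equiv> gt_patterns n x"

lemma finite_P: "finite P"
  using card_gt_patterns_det[of n x] x_strict by blast

lemma row_less_Suc:
  assumes \<Lambda>: "\<Lambda> \<in> P" and "Suc i < k" "k \<le> n"
  shows "\<Lambda> (k, i) < \<Lambda> (k, Suc i)"
proof (cases "k = n")
  case True
  then show ?thesis
    using gt_patternsD(2)[OF \<Lambda>, of i] gt_patternsD(2)[OF \<Lambda>, of "Suc i"] x_strict[of i] assms by simp
next
  case False
  then show ?thesis
    using gt_patternsD(4)[OF \<Lambda>, of i k] gt_patternsD(3)[OF \<Lambda>, of "Suc i" k] assms by simp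
qed

lemma row_less:
  assumes \<Lambda>: "\<Lambda> \<in> P" and "i < j" "j < k" "k \<le> n"
  shows "\<Lambda> (k, i) < \<Lambda> (k, j)"
proof -
  have "strict_mono_on {..<k} (\<lambda>i. \<Lambda> (k, i))"
    using row_less_Suc[OF \<Lambda>] assms(4) by (intro strict_mono_onI_Suc) auto
  then show ?thesis using assms by (auto simp: strict_mono_on_def)
qed

lemma row_inj:
  assumes "\<Lambda> \<in> P" "i < k" "j < k" "k \<le> n"
  shows "\<Lambda> (k, i) = \<Lambda> (k, j) \<longleftrightarrow> i = j"
  using row_less[OF assms(1), of i j k] row_less[OF assms(1), of j i k] assms
  by (metis less_irrefl nat_neq_iff)

lemma bump_in_P_iff:
  assumes \<Lambda>: "\<Lambda> \<in> P" and k: "Suc k < n" and i: "i \<le> k"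
  shows "bump \<Lambda> (Suc k) i \<in> P \<longleftrightarrow>
    \<Lambda> (Suc k, i) + 1 < \<Lambda> (Suc (Suc k), Suc i) \<and> (i < k \<longrightarrow> \<Lambda> (Suc k, i) < \<Lambda> (k, i))"
    (is "_ \<longleftrightarrow> ?R")
proof
  assume B: "bump \<Lambda> (Suc k) i \<in> P"
  show ?R
    using gt_patternsD(4)[OF B, of i "Suc k"] gt_patternsD(3)[OF B, of i k] k i by (auto simp: bump_def)
next
  assume R: ?R
  show "bump \<Lambda> (Suc k) i \<in> P"
  proof (rule gt_patternsI)
    fix l j assume "j < l" "l < n"
    then show "bump \<Lambda> (Suc k) i (Suc l, j) \<le> bump \<Lambda> (Suc k) i (l, j)"
      "bump \<Lambda> (Suc k) i (l, j) < bump \<Lambda> (Suc k) i (Suc l, Suc j)"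
      using R gt_patternsD(3,4)[OF \<Lambda>, of j l] by (auto simp: bump_def)
  qed (use gt_patternsD(1,2)[OF \<Lambda>] k i in \<open>auto simp: bump_def\<close>)
qed

lemma drop_at_in_P_iff:
  assumes \<Lambda>: "\<Lambda> \<in> P" and k: "Suc k < n" and i: "i \<le> k"
  shows "drop_at \<Lambda> (Suc k) i \<in> P \<longleftrightarrow>
    \<Lambda> (Suc (Suc k), i) < \<Lambda> (Suc k, i) \<and> (0 < i \<longrightarrow> \<Lambda> (k, i - 1) + 1 < \<Lambda> (Suc k, i))"
    (is "_ \<longleftrightarrow> ?R")
proof
  assume B: "drop_at \<Lambda> (Suc k) i \<in> P"
  show ?R
    using gt_patternsD(3)[OF B, of i "Suc k"] gt_patternsD(4)[OF B, of "i - 1" k] k i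
    by (cases i) (auto simp: drop_at_def)
next
  assume R: ?R
  show "drop_at \<Lambda> (Suc k) i \<in> P"
  proof (rule gt_patternsI)
    fix l j assume "j < l" "l < n"
    then show "drop_at \<Lambda> (Suc k) i (Suc l, j) \<le> drop_at \<Lambda> (Suc k) i (l, j)"
      "drop_at \<Lambda> (Suc k) i (l, j) < drop_at \<Lambda> (Suc k) i (Suc l, Suc j)"
      using R gt_patternsD(3,4)[OF \<Lambda>, of j l] by (auto simp: drop_at_def)
  qed (use gt_patternsD(1,2)[OF \<Lambda>] k i in \<open>auto simp: drop_at_def\<close>)
qed

text \<open>
  If the start and the end of a raising and a lowering step are patterns, then both intermediate
  stages are patterns, since an inequality between two entries is tightened or relaxed by the two steps in
  the same direction when it involves both entries.
\<close>

lemma square_in_P: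
  assumes \<Lambda>: "\<Lambda> \<in> P" and \<Lambda>': "bump (drop_at \<Lambda> k i) l j \<in> P" and ne: "(k, i) \<noteq> (l, j)"
    and "k < n" "l < n" "i < k" "j < l"
  shows "drop_at \<Lambda> k i \<in> P" "bump \<Lambda> l j \<in> P"
proof -
  note D = gt_patternsD[OF \<Lambda>] and D' = gt_patternsD[OF \<Lambda>']
  show "drop_at \<Lambda> k i \<in> P"
  proof (rule gt_patternsI)
    fix r s assume "s < r" "r < n"
    then show "drop_at \<Lambda> k i (Suc r, s) \<le> drop_at \<Lambda> k i (r, s)"
      "drop_at \<Lambda> k i (r, s) < drop_at \<Lambda> k i (Suc r, Suc s)"
      using D(3,4)[of s r] D'(3,4)[of s r] ne by (auto simp: drop_at_def bump_def split: if_splits)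
  qed (use D(1,2) assms in \<open>auto simp: drop_at_def\<close>)
  show "bump \<Lambda> l j \<in> P"
  proof (rule gt_patternsI)
    fix r s assume "s < r" "r < n"
    then show "bump \<Lambda> l j (Suc r, s) \<le> bump \<Lambda> l j (r, s)"
      "bump \<Lambda> l j (r, s) < bump \<Lambda> l j (Suc r, Suc s)"
      using D(3,4)[of s r] D'(3,4)[of s r] ne by (auto simp: drop_at_def bump_def split: if_splits)
  qed (use D(1,2) assms in \<open>auto simp: bump_def\<close>)
qed

text \<open>
  Neighbouring entries of a row that differ by one correspond to equal parts, which force the entries
  above and below.  These are the cancelled double poles in the residue identity.
\<close>

lemma adjacent_entries:
  assumes \<Lambda>: "\<Lambda> \<in> P" and k: "Suc k < n" and ij: "i \<le> k" "j \<le> k"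
    and adj: "\<Lambda> (Suc k, i) + 1 = \<Lambda> (Suc k, j)"
  shows "i < k" "j = Suc i" "\<Lambda> (k, i) = \<Lambda> (Suc k, i)" "\<Lambda> (Suc (Suc k), j) = \<Lambda> (Suc k, j)"
proof -
  have "i < j"
    using row_less[OF \<Lambda>, of j i "Suc k"] adj k ij by (cases i j rule: linorder_cases) auto
  then show "i < k" using ij by simp
  have z: "\<Lambda> (Suc k, i) \<le> \<Lambda> (k, i)" "\<Lambda> (k, i) < \<Lambda> (Suc k, Suc i)"
    using gt_patternsD(3,4)[OF \<Lambda>, of i k] \<open>i < k\<close> k by auto
  have y: "\<Lambda> (Suc k, i) < \<Lambda> (Suc (Suc k), Suc i)" "\<Lambda> (Suc (Suc k), Suc i) \<le> \<Lambda> (Suc k, Suc i)"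
    using gt_patternsD(4)[OF \<Lambda>, of i "Suc k"] gt_patternsD(3)[OF \<Lambda>, of "Suc i" "Suc k"] \<open>i < k\<close> k by auto
  show j: "j = Suc i"
  proof (rule ccontr)
    assume "j \<noteq> Suc i"
    then have "\<Lambda> (Suc k, Suc i) < \<Lambda> (Suc k, j)"
      using row_less[OF \<Lambda>, of "Suc i" j "Suc k"] \<open>i < j\<close> ij k by simp
    then show False using z adj by simp
  qed
  show "\<Lambda> (k, i) = \<Lambda> (Suc k, i)" "\<Lambda> (Suc (Suc k), j) = \<Lambda> (Suc k, j)"
    using z y adj j by auto
qed

lemma up_coef_nonzero:
  assumes \<Lambda>: "\<Lambda> \<in> P" and k: "Suc k < n" and i: "i \<le> k" and B: "bump \<Lambda> (Suc k) i \<in> P"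
  shows "up_coef k i \<Lambda> \<noteq> 0"
proof -
  have c: "\<Lambda> (Suc k, i) + 1 < \<Lambda> (Suc (Suc k), Suc i)"
    using bump_in_P_iff[OF \<Lambda> k i] B by simp
  have "\<Lambda> (Suc k, i) + 1 \<noteq> \<Lambda> (Suc (Suc k), j)" if "j < Suc (Suc k)" for j
  proof (cases "j \<le> i")
    case True
    then have "\<Lambda> (Suc (Suc k), j) \<le> \<Lambda> (Suc (Suc k), i)"
      using row_less[OF \<Lambda>, of j i "Suc (Suc k)"] i k by (cases "j = i") auto
    then show ?thesis using gt_patternsD(3)[OF \<Lambda>, of i "Suc k"] i k by simp
  next
    case False
    then have "\<Lambda> (Suc (Suc k), Suc i) \<le> \<Lambda> (Suc (Suc k), j)"
      using row_less[OF \<Lambda>, of "Suc i" j "Suc (Suc k)"] that k by (cases "j = Suc i") auto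
    then show ?thesis using c by simp
  qed
  then have "of_int (\<Lambda> (Suc k, i) + 1 - \<Lambda> (Suc (Suc k), j)) \<noteq> (0 :: complex)" if "j < Suc (Suc k)" for j
    using that by (simp only: of_int_eq_0_iff) simp
  moreover have "of_int (\<Lambda> (Suc k, i) - \<Lambda> (Suc k, j)) \<noteq> (0 :: complex)" if "j \<in> {..k} - {i}" for j
    using row_inj[OF \<Lambda>, of i "Suc k" j] that i k by (simp only: of_int_eq_0_iff) simp
  ultimately show ?thesis
    unfolding up_coef_def by (simp del: prod.lessThan_Suc of_int_diff of_int_add)
qed

lemma down_coef_nonzero:
  assumes \<Lambda>: "\<Lambda> \<in> P" and k: "Suc k < n" and i: "i \<le> k" and B: "bump \<Lambda> (Suc k) i \<in> P"
  shows "down_coef k i \<Lambda> \<noteq> 0"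
proof -
  have c: "i < k \<longrightarrow> \<Lambda> (Suc k, i) < \<Lambda> (k, i)"
    using bump_in_P_iff[OF \<Lambda> k i] B by simp
  have "\<Lambda> (Suc k, i) \<noteq> \<Lambda> (k, j)" if "j < k" for j
  proof (cases "j < i")
    case True
    then have "\<Lambda> (Suc k, Suc j) \<le> \<Lambda> (Suc k, i)"
      using row_less[OF \<Lambda>, of "Suc j" i "Suc k"] i k by (cases "Suc j = i") auto
    then show ?thesis using gt_patternsD(4)[OF \<Lambda>, of j k] that k by simp
  next
    case False
    then have "\<Lambda> (k, i) \<le> \<Lambda> (k, j)"
      using row_less[OF \<Lambda>, of i j k] that k by (cases "j = i") auto
    then show ?thesis using c False that by simp
  qed
  then have "of_int (\<Lambda> (Suc k, i) - \<Lambda> (k, j)) \<noteq> (0 :: complex)" if "j < k" for j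
    using that by (simp only: of_int_eq_0_iff) simp
  moreover have "of_int (\<Lambda> (Suc k, i) + 1 - \<Lambda> (Suc k, j)) \<noteq> (0 :: complex)" if "j \<in> {..k} - {i}" for j
    using adjacent_entries(1,3)[OF \<Lambda> k i, of j] that c by (simp only: of_int_eq_0_iff) auto
  ultimately show ?thesis
    unfolding down_coef_def by (simp del: prod.lessThan_Suc of_int_diff of_int_add)
qed

end

text \<open>
  Subtracting \<open>i\<close> returns to the parts of the partition in row \<open>k\<close>, so this is its size.
\<close>

definition row_sum :: "(nat \<times> nat \<Rightarrow> int) \<Rightarrow> nat \<Rightarrow> int" where
  "row_sum \<Lambda> k = (\<Sum>i<k. \<Lambda> (k, i) - int i)"

definition weight :: "(nat \<times> nat \<Rightarrow> int) \<Rightarrow> nat \<Rightarrow> int" where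
  "weight \<Lambda> k = row_sum \<Lambda> (Suc k) - row_sum \<Lambda> k"

context gelfand_tsetlin
begin

text \<open>
  The products of a raising and a lowering coefficient are the residues of one rational function.  Its
  poles are the entries \<open>X\<close> of row \<open>Suc k\<close> and the same entries \<open>X'\<close> lowered by one;
  its zeros \<open>Y\<close> and \<open>Z\<close> come from the rows above and below.  Raising entry \<open>i\<close> belongs to
  the pole at the entry, lowering it to the pole one below.  A step that leaves the set of patterns has a
  vanishing residue or belongs to a cancelled pole.
\<close>

lemma sum_up_down_coef:
  assumes \<Lambda>: "\<Lambda> \<in> P" and k: "Suc k < n"
  defines "A \<equiv> \<lambda>i M. up_coef k i M * down_coef k i M"
  shows "(\<Sum>i\<le>k. if drop_at \<Lambda> (Suc k) i \<in> P then A i (drop_at \<Lambda> (Suc k) i) else 0) -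
    (\<Sum>i\<le>k. if bump \<Lambda> (Suc k) i \<in> P then A i \<Lambda> else 0) =
    of_int (weight \<Lambda> k - weight \<Lambda> (Suc k))"
proof -
  define a where "a i = (of_int (\<Lambda> (Suc k, i)) :: complex)" for i
  define y where "y j = (of_int (\<Lambda> (Suc (Suc k), j)) :: complex)" for j
  define z where "z j = (of_int (\<Lambda> (k, j)) :: complex)" for j
  define X where "X = a ` {..k}"
  define X' where "X' = (\<lambda>i. a i - 1) ` {..k}"
  define Y where "Y = (\<lambda>j. y j - 1) ` {..<Suc (Suc k)}"
  define Z where "Z = z ` {..<k}"
  have inj_a: "inj_on a {..k}"
    using row_inj[OF \<Lambda>, of _ "Suc k"] k by (auto simp: inj_on_def a_def)
  have inj_a': "inj_on (\<lambda>i. a i - 1) {..k}" using inj_a by (simp add: inj_on_def)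
  have inj_y: "inj_on (\<lambda>j. y j - 1) {..<Suc (Suc k)}"
    using row_inj[OF \<Lambda>, of _ "Suc (Suc k)"] k by (auto simp: inj_on_def y_def)
  have inj_z: "inj_on z {..<k}"
    using row_inj[OF \<Lambda>, of _ k] k by (auto simp: inj_on_def z_def)
  have adj: "a i + 1 = a j \<longleftrightarrow> \<Lambda> (Suc k, i) + 1 = \<Lambda> (Suc k, j)" for i j
    unfolding a_def by (metis of_int_1 of_int_add of_int_eq_iff)
  have in_X': "a i \<in> X' \<longleftrightarrow> (\<exists>j\<le>k. \<Lambda> (Suc k, i) + 1 = \<Lambda> (Suc k, j))" for i
    unfolding X'_def adj[symmetric] by (auto simp: image_iff algebra_simps)
  have in_X: "a i - 1 \<in> X \<longleftrightarrow> (\<exists>j\<le>k. \<Lambda> (Suc k, j) + 1 = \<Lambda> (Suc k, i))" for i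
  proof -
    have "a i - 1 = a j \<longleftrightarrow> a j + 1 = a i" for j by (auto simp: algebra_simps)
    then show ?thesis by (auto simp: X_def image_iff simp flip: adj)
  qed
  define g where "g s = (\<Prod>y\<in>Y. s - y) * (\<Prod>z\<in>Z. s - z) /
    ((\<Prod>x\<in>X - {s}. s - x) * (\<Prod>x\<in>X' - {s}. s - x))" for s
  have common: "X \<inter> X' \<subseteq> Y \<inter> Z"
  proof
    fix s assume s: "s \<in> X \<inter> X'"
    then obtain i where i: "i \<le> k" "s = a i" by (auto simp: X_def)
    with s in_X' obtain j where j: "j \<le> k" "\<Lambda> (Suc k, i) + 1 = \<Lambda> (Suc k, j)" by auto
    note E = adjacent_entries[OF \<Lambda> k i(1) j]
    have "s = z i" using E(3) i by (simp add: a_def z_def)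
    moreover have sy: "s = y j - 1" 
      using E(4) i(2) arg_cong[OF j(2), of "of_int :: int \<Rightarrow> complex"] by (simp add: a_def y_def eq_diff_eq)
    moreover have "s \<in> Y" unfolding Y_def using sy j(1) by (intro image_eqI[of _ _ j]) auto
    ultimately show "s \<in> Y \<inter> Z" using E(1) by (auto simp: Z_def)
  qed
  have card: "card Y + card Z = card X + card X'"
    using inj_a inj_a' inj_y inj_z by (simp add: X_def X'_def Y_def Z_def card_image)
  have res: "(\<Sum>s\<in>X - X'. g s) + (\<Sum>s\<in>X' - X. g s) = \<Sum>X + \<Sum>X' - \<Sum>Y - \<Sum>Z"
    unfolding g_def by (rule sum_residues[OF _ _ _ _ card common]) (simp_all add: X_def X'_def Y_def Z_def)
  have prodY: "(\<Prod>y\<in>Y. s - y) = (\<Prod>j<Suc (Suc k). s - (y j - 1))" for s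
    unfolding Y_def by (subst prod.reindex[OF inj_y]) simp
  have prodZ: "(\<Prod>z\<in>Z. s - z) = (\<Prod>j<k. s - z j)" for s
    unfolding Z_def by (subst prod.reindex[OF inj_z]) simp
  have prodX: "(\<Prod>x\<in>X. s - x) = (\<Prod>j\<le>k. s - a j)" for s
    unfolding X_def by (subst prod.reindex[OF inj_a]) simp
  have prodX': "(\<Prod>x\<in>X'. s - x) = (\<Prod>j\<le>k. s - (a j - 1))" for s
    unfolding X'_def by (subst prod.reindex[OF inj_a']) simp
  \<comment> \<open>The residue at an entry, with sign changed, is the contribution of raising that entry.\<close>
  have up_term: "(if a i \<notin> X' then g (a i) else 0) = - (if bump \<Lambda> (Suc k) i \<in> P then A i \<Lambda> else 0)"
    if i: "i \<le> k" for i
  proof (cases "bump \<Lambda> (Suc k) i \<in> P")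
    case True
    then have nX': "a i \<notin> X'"
      using bump_in_P_iff[OF \<Lambda> k i] adjacent_entries(1,3)[OF \<Lambda> k i] in_X' by fastforce
    have "X - {a i} = a ` ({..k} - {i})"
      using inj_a i by (auto simp: X_def inj_on_def)
    then have 1: "(\<Prod>x\<in>X - {a i}. a i - x) = (\<Prod>j\<in>{..k} - {i}. a i - a j)"
      using inj_a by (simp add: prod.reindex inj_on_diff)
    have "(\<Prod>x\<in>X' - {a i}. a i - x) = (\<Prod>j\<le>k. a i - (a j - 1))"
      using nX' prodX' by simp
    also have "\<dots> = (\<Prod>j\<in>{..k} - {i}. a i - (a j - 1))"
      using i by (subst prod.remove[of _ i]) auto
    finally have 2: "(\<Prod>x\<in>X' - {a i}. a i - x) = (\<Prod>j\<in>{..k} - {i}. a i - (a j - 1))" .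
    have "g (a i) = - A i \<Lambda>"
      unfolding g_def A_def up_coef_def down_coef_def prodY prodZ 1 2
      by (simp add: a_def y_def z_def algebra_simps del: prod.lessThan_Suc)
    then show ?thesis using True nX' by simp
  next
    case False
    have "g (a i) = 0" if "a i \<notin> X'"
    proof -
      have "\<Lambda> (Suc k, i) + 1 = \<Lambda> (Suc (Suc k), Suc i) \<or> (i < k \<and> \<Lambda> (Suc k, i) = \<Lambda> (k, i))"
        using False bump_in_P_iff[OF \<Lambda> k i] gt_patternsD(4)[OF \<Lambda>, of i "Suc k"]
          gt_patternsD(3)[OF \<Lambda>, of i k] i k by force
      then have "(\<exists>j<Suc (Suc k). a i - (y j - 1) = 0) \<or> (\<exists>j<k. a i - z j = 0)"
      proof
        assume "\<Lambda> (Suc k, i) + 1 = \<Lambda> (Suc (Suc k), Suc i)"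
        from arg_cong[OF this, of "of_int :: int \<Rightarrow> complex"]
        have "a i - (y (Suc i) - 1) = 0" by (simp add: a_def y_def algebra_simps)
        then show ?thesis using i by (intro disjI1 exI[of _ "Suc i"]) simp
      qed (auto simp: a_def z_def)
      then have "(\<Prod>j<Suc (Suc k). a i - (y j - 1)) = 0 \<or> (\<Prod>j<k. a i - z j) = 0"
        by (auto simp only: prod_zero_iff finite_lessThan lessThan_iff)
      then show ?thesis by (auto simp only: g_def prodY prodZ mult_zero_left mult_zero_right div_0)
    qed
    then show ?thesis using False by simp
  qed
  \<comment> \<open>The residue one below an entry is the contribution of lowering that entry.\<close>
  have down_term: "(if a i - 1 \<notin> X then g (a i - 1) else 0) =
      (if drop_at \<Lambda> (Suc k) i \<in> P then A i (drop_at \<Lambda> (Suc k) i) else 0)"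
    if i: "i \<le> k" for i
  proof (cases "drop_at \<Lambda> (Suc k) i \<in> P")
    case True
    have nX: "a i - 1 \<notin> X"
    proof
      assume "a i - 1 \<in> X"
      then obtain j where j: "j \<le> k" "\<Lambda> (Suc k, j) + 1 = \<Lambda> (Suc k, i)" using in_X by auto
      show False
        using adjacent_entries[OF \<Lambda> k j(1) i j(2)] drop_at_in_P_iff[OF \<Lambda> k i] True by simp
    qed
    have "X' - {a i - 1} = (\<lambda>j. a j - 1) ` ({..k} - {i})"
      using inj_a i by (auto simp: X'_def inj_on_def)
    then have 1: "(\<Prod>x\<in>X' - {a i - 1}. a i - 1 - x) = (\<Prod>j\<in>{..k} - {i}. a i - 1 - (a j - 1))"
      using inj_a' by (simp add: prod.reindex inj_on_diff)
    have "(\<Prod>x\<in>X - {a i - 1}. a i - 1 - x) = (\<Prod>j\<le>k. a i - 1 - a j)"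
      using nX prodX by simp
    also have "\<dots> = - (\<Prod>j\<in>{..k} - {i}. a i - 1 - a j)"
      using i by (subst prod.remove[of _ i]) auto
    finally have 2: "(\<Prod>x\<in>X - {a i - 1}. a i - 1 - x) = - (\<Prod>j\<in>{..k} - {i}. a i - 1 - a j)" .
    have 3: "(\<Prod>j\<in>{..k} - {i}. f (drop_at \<Lambda> (Suc k) i (Suc k, j))) = (\<Prod>j\<in>{..k} - {i}. f (\<Lambda> (Suc k, j)))"
      for f :: "int \<Rightarrow> complex"
      by (intro prod.cong) (auto simp: drop_at_def)
    have 4: "drop_at \<Lambda> (Suc k) i (Suc k, i) = \<Lambda> (Suc k, i) - 1"
      "drop_at \<Lambda> (Suc k) i (k, j) = \<Lambda> (k, j)"
      "drop_at \<Lambda> (Suc k) i (Suc (Suc k), j) = \<Lambda> (Suc (Suc k), j)" for j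
      by (auto simp: drop_at_def)
    have "g (a i - 1) = A i (drop_at \<Lambda> (Suc k) i)"
      unfolding g_def A_def up_coef_def down_coef_def prodY prodZ 1 2 4
        3[of "\<lambda>b. of_int (\<Lambda> (Suc k, i) - 1 + 1 - b)"] 3[of "\<lambda>b. of_int (\<Lambda> (Suc k, i) - 1 - b)"]
      by (simp add: a_def y_def z_def algebra_simps del: prod.lessThan_Suc)
    then show ?thesis using True nX by simp
  next
    case False
    have "g (a i - 1) = 0" if "a i - 1 \<notin> X"
    proof -
      have "\<Lambda> (Suc (Suc k), i) = \<Lambda> (Suc k, i) \<or> (0 < i \<and> \<Lambda> (k, i - 1) + 1 = \<Lambda> (Suc k, i))"
        using False drop_at_in_P_iff[OF \<Lambda> k i] gt_patternsD(3)[OF \<Lambda>, of i "Suc k"]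
          gt_patternsD(4)[OF \<Lambda>, of "i - 1" k] i k by force
      then have "(\<exists>j<Suc (Suc k). a i - 1 - (y j - 1) = 0) \<or> (\<exists>j<k. a i - 1 - z j = 0)"
      proof
        assume "\<Lambda> (Suc (Suc k), i) = \<Lambda> (Suc k, i)"
        then show ?thesis using i by (intro disjI1 exI[of _ i]) (simp add: a_def y_def)
      next
        assume *: "0 < i \<and> \<Lambda> (k, i - 1) + 1 = \<Lambda> (Suc k, i)"
        then have "z (i - 1) + 1 = a i" unfolding a_def z_def by (metis of_int_1 of_int_add)
        then show ?thesis using i *
          by (intro disjI2 exI[of _ "i - 1"]) (auto simp: algebra_simps)
      qed
      then have "(\<Prod>j<Suc (Suc k). a i - 1 - (y j - 1)) = 0 \<or> (\<Prod>j<k. a i - 1 - z j) = 0"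
        by (auto simp only: prod_zero_iff finite_lessThan lessThan_iff)
      then show ?thesis by (auto simp only: g_def prodY prodZ mult_zero_left mult_zero_right div_0)
    qed
    then show ?thesis using False by simp
  qed
  have "(\<Sum>s\<in>X - X'. g s) = (\<Sum>s\<in>X. if s \<notin> X' then g s else 0)"
    by (simp add: X_def sum.If_cases set_diff_eq Int_def)
  also have "\<dots> = (\<Sum>i\<le>k. if a i \<notin> X' then g (a i) else 0)"
    unfolding X_def by (subst sum.reindex[OF inj_a]) simp
  also have "\<dots> = - (\<Sum>i\<le>k. if bump \<Lambda> (Suc k) i \<in> P then A i \<Lambda> else 0)"
    unfolding sum_negf[symmetric] by (intro sum.cong refl up_term) simp
  finally have up_sum: "(\<Sum>s\<in>X - X'. g s) = - (\<Sum>i\<le>k. if bump \<Lambda> (Suc k) i \<in> P then A i \<Lambda> else 0)" .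
  have "(\<Sum>s\<in>X' - X. g s) = (\<Sum>s\<in>X'. if s \<notin> X then g s else 0)"
    by (simp add: X'_def sum.If_cases set_diff_eq Int_def)
  also have "\<dots> = (\<Sum>i\<le>k. if a i - 1 \<notin> X then g (a i - 1) else 0)"
    unfolding X'_def by (subst sum.reindex[OF inj_a']) simp
  also have "\<dots> = (\<Sum>i\<le>k. if drop_at \<Lambda> (Suc k) i \<in> P then A i (drop_at \<Lambda> (Suc k) i) else 0)"
    by (intro sum.cong refl down_term) simp
  finally have down_sum: "(\<Sum>s\<in>X' - X. g s) =
    (\<Sum>i\<le>k. if drop_at \<Lambda> (Suc k) i \<in> P then A i (drop_at \<Lambda> (Suc k) i) else 0)" .
  have "\<Sum>X + \<Sum>X' - \<Sum>Y - \<Sum>Z =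
    (\<Sum>i\<le>k. a i) + (\<Sum>i\<le>k. a i - 1) - (\<Sum>j<Suc (Suc k). y j - 1) - (\<Sum>j<k. z j)"
    unfolding X_def X'_def Y_def Z_def
    by (simp only: sum.reindex[OF inj_a] sum.reindex[OF inj_a'] sum.reindex[OF inj_y] sum.reindex[OF inj_z] o_def)
  also have "\<dots> = of_int (weight \<Lambda> k - weight \<Lambda> (Suc k))"
    by (simp add: weight_def row_sum_def a_def y_def z_def sum_subtractf lessThan_Suc_atMost
        flip: lessThan_Suc_atMost)
  finally show ?thesis using res up_sum down_sum by simp
qed

end

section \<open>Commutation relations of the pattern operators\<close>

context gelfand_tsetlin
begin

text \<open>
  The operators are defined for an arbitrary coefficient function, because the transpose of a
  lowering operator is a raising operator with the coefficients of the former (\<open>sum_mult_lower\<close>), and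
  the analysis of singular vectors is needed for both kinds of coefficients.
\<close>

definition raise :: "(nat \<Rightarrow> nat \<Rightarrow> (nat \<times> nat \<Rightarrow> int) \<Rightarrow> complex) \<Rightarrow> nat \<Rightarrow>
    ((nat \<times> nat \<Rightarrow> int) \<Rightarrow> complex) \<Rightarrow> (nat \<times> nat \<Rightarrow> int) \<Rightarrow> complex" where
  "raise a k c \<Lambda> = (if \<Lambda> \<in> P
     then \<Sum>i\<le>k. a k i (drop_at \<Lambda> (Suc k) i) * c (drop_at \<Lambda> (Suc k) i) else 0)"

definition lower :: "(nat \<Rightarrow> nat \<Rightarrow> (nat \<times> nat \<Rightarrow> int) \<Rightarrow> complex) \<Rightarrow> nat \<Rightarrow>
    ((nat \<times> nat \<Rightarrow> int) \<Rightarrow> complex) \<Rightarrow> (nat \<times> nat \<Rightarrow> int) \<Rightarrow> complex" where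
  "lower b k c \<Lambda> = (if \<Lambda> \<in> P then \<Sum>i\<le>k. b k i \<Lambda> * c (bump \<Lambda> (Suc k) i) else 0)"

definition diag :: "nat \<Rightarrow> ((nat \<times> nat \<Rightarrow> int) \<Rightarrow> complex) \<Rightarrow> (nat \<times> nat \<Rightarrow> int) \<Rightarrow> complex" where
  "diag k c \<Lambda> = of_int (weight \<Lambda> k) * c \<Lambda>"

definition supported :: "((nat \<times> nat \<Rightarrow> int) \<Rightarrow> complex) \<Rightarrow> bool" where
  "supported c \<longleftrightarrow> (\<forall>\<Lambda>. \<Lambda> \<notin> P \<longrightarrow> c \<Lambda> = 0)"

lemma supported_raise: "supported (raise a k c)"
  and supported_lower: "supported (lower b k c)"
  by (auto simp: supported_def raise_def lower_def)

text \<open>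
  Off the diagonal the paths in the two orders cancel in pairs; on the diagonal the residue identity
  gives the difference of the weights.
\<close>

lemma raise_lower_commutator:
  assumes c: "supported c" and k: "Suc k < n" and l: "Suc l < n"
  shows "raise up_coef k (lower down_coef l c) \<Lambda> - lower down_coef l (raise up_coef k c) \<Lambda> =
    (if k = l then diag k c \<Lambda> - diag (Suc k) c \<Lambda> else 0)"
proof (cases "\<Lambda> \<in> P")
  case False
  then show ?thesis using c by (simp add: raise_def lower_def diag_def supported_def)
next
  case \<Lambda>: True
  let ?D = "\<lambda>i. drop_at \<Lambda> (Suc k) i" and ?B = "\<lambda>j. bump \<Lambda> (Suc l) j"
  \<comment> \<open>\<open>S1\<close> and \<open>S2\<close> are the contributions of the two paths that lead to \<open>\<Lambda>\<close> by a lowering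
    step at \<open>j\<close> and a raising step at \<open>i\<close>, in the two possible orders.\<close>
  define S1 where "S1 i j = (if ?D i \<in> P
    then up_coef k i (?D i) * down_coef l j (?D i) * c (bump (?D i) (Suc l) j) else 0)" for i j
  define S2 where "S2 i j = (if ?B j \<in> P
    then down_coef l j \<Lambda> * up_coef k i (drop_at (?B j) (Suc k) i) * c (drop_at (?B j) (Suc k) i) else 0)" for i j
  define T where "T i = (if ?D i \<in> P then up_coef k i (?D i) * down_coef k i (?D i) else 0) -
    (if bump \<Lambda> (Suc k) i \<in> P then up_coef k i \<Lambda> * down_coef k i \<Lambda> else 0)" for i
  have "S1 i j - S2 i j = (if k = l \<and> j = i then T i * c \<Lambda> else 0)" if ij: "i \<le> k" "j \<le> l" for i j
  proof (cases "k = l \<and> i = j")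
    case True
    then show ?thesis by (auto simp: S1_def S2_def T_def algebra_simps)
  next
    case False
    let ?\<Lambda>' = "bump (?D i) (Suc l) j"
    have ne: "(Suc k, i) \<noteq> (Suc l, j)" using False by auto
    have eq: "drop_at (?B j) (Suc k) i = ?\<Lambda>'" using bump_drop_at_commute[OF ne] by simp
    have "S1 i j = S2 i j"
    proof (cases "c ?\<Lambda>' = 0")
      case True
      then show ?thesis by (simp add: S1_def S2_def eq)
    next
      case False
      then have "?\<Lambda>' \<in> P" using c by (auto simp: supported_def)
      from square_in_P[OF \<Lambda> this ne k l] ij have "?D i \<in> P" "?B j \<in> P" by auto
      moreover have "up_coef k i (?D i) * down_coef l j (?D i) = down_coef l j \<Lambda> * up_coef k i ?\<Lambda>'"
        using up_down_coef_square[of k i l j "?D i"] ne ij by simp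
      ultimately show ?thesis by (simp add: S1_def S2_def eq)
    qed
    then show ?thesis using False by auto
  qed
  note diff = this
  have "raise up_coef k (lower down_coef l c) \<Lambda> = (\<Sum>i\<le>k. \<Sum>j\<le>l. S1 i j)"
    unfolding raise_def lower_def S1_def using \<Lambda>
    by (auto intro!: sum.cong simp: sum_distrib_left mult.assoc)
  moreover have "lower down_coef l (raise up_coef k c) \<Lambda> = (\<Sum>j\<le>l. \<Sum>i\<le>k. S2 i j)"
    unfolding raise_def lower_def S2_def using \<Lambda>
    by (auto intro!: sum.cong simp: sum_distrib_left mult.assoc)
  moreover have "(\<Sum>j\<le>l. \<Sum>i\<le>k. S2 i j) = (\<Sum>i\<le>k. \<Sum>j\<le>l. S2 i j)" by (rule sum.swap)
  ultimately have "raise up_coef k (lower down_coef l c) \<Lambda> - lower down_coef l (raise up_coef k c) \<Lambda> =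
      (\<Sum>i\<le>k. \<Sum>j\<le>l. S1 i j - S2 i j)"
    by (simp add: sum_subtractf)
  also have "\<dots> = (\<Sum>i\<le>k. \<Sum>j\<le>l. if k = l \<and> j = i then T i * c \<Lambda> else 0)"
    using diff by (intro sum.cong) auto
  also have "\<dots> = (if k = l then (\<Sum>i\<le>k. T i) * c \<Lambda> else 0)"
    by (auto simp: sum_distrib_right intro!: sum.cong)
  also have "(\<Sum>i\<le>k. T i) = of_int (weight \<Lambda> k - weight \<Lambda> (Suc k))"
    unfolding T_def sum_subtractf by (rule sum_up_down_coef[OF \<Lambda> k])
  finally show ?thesis by (auto simp: diag_def algebra_simps)
qed

lemma row_sum_bump:
  "i < k \<Longrightarrow> row_sum (bump \<Lambda> k i) l = row_sum \<Lambda> l + (if l = k then 1 else 0)"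
proof (cases "l = k")
  case True
  assume i: "i < k"
  have "row_sum (bump \<Lambda> k i) k = (\<Sum>j<k. (\<Lambda> (k, j) - int j) + (if j = i then 1 else 0))"
    unfolding row_sum_def by (intro sum.cong) (auto simp: bump_def)
  also have "\<dots> = row_sum \<Lambda> k + 1" using i by (simp add: sum.distrib row_sum_def)
  finally show ?thesis using True by simp
qed (auto simp: row_sum_def bump_def)

lemma weight_bump:
  "i \<le> k \<Longrightarrow> weight (bump \<Lambda> (Suc k) i) l = weight \<Lambda> l + (if l = k then 1 else 0) - (if l = Suc k then 1 else 0)"
  by (auto simp: weight_def row_sum_bump)

lemma diag_lower:
  "diag l (lower b k c) \<Lambda> =
    lower b k (diag l c) \<Lambda> + ((if l = Suc k then 1 else 0) - (if l = k then 1 else 0)) * lower b k c \<Lambda>"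
proof (cases "\<Lambda> \<in> P")
  case True
  have "lower b k (diag l c) \<Lambda> =
    (\<Sum>i\<le>k. (of_int (weight \<Lambda> l) + (if l = k then 1 else 0) - (if l = Suc k then 1 else 0)) *
      (b k i \<Lambda> * c (bump \<Lambda> (Suc k) i)))"
    unfolding lower_def diag_def using True by (auto intro!: sum.cong simp: weight_bump algebra_simps)
  also have "\<dots> = (of_int (weight \<Lambda> l) + (if l = k then 1 else 0) - (if l = Suc k then 1 else 0)) *
      lower b k c \<Lambda>"
    using True by (simp only: lower_def sum_distrib_left if_True)
  finally show ?thesis by (simp add: diag_def algebra_simps)
qed (simp add: diag_def lower_def)

end

section \<open>Singular vectors in the pattern space\<close>

context gelfand_tsetlin
begin

text \<open>
  The unique pattern in which no entry below the top row can be raised; in terms of partitions, each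
  row consists of the first parts of the top row.
\<close>

definition top_pattern :: "nat \<times> nat \<Rightarrow> int" where
  "top_pattern = (\<lambda>(k, i). if i < k \<and> k \<le> n then x (i + (n - k)) - int (n - k) else 0)"

lemma top_pattern_step:
  "i < k \<Longrightarrow> k < n \<Longrightarrow> top_pattern (k, i) + 1 = top_pattern (Suc k, Suc i)"
  by (auto simp: top_pattern_def Suc_diff_Suc of_nat_diff simp flip: Suc_diff_Suc)

lemma top_pattern_in_P: "top_pattern \<in> P"
proof (rule gt_patternsI)
  fix k i assume ik: "i < k" "k < n"
  have n: "n - k = Suc (n - Suc k)" using ik by simp
  have "x (i + (n - Suc k)) < x (Suc (i + (n - Suc k)))" using ik by (intro x_strict) simp
  then show "top_pattern (Suc k, i) \<le> top_pattern (k, i)"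
    using ik by (simp add: top_pattern_def n)
  show "top_pattern (k, i) < top_pattern (Suc k, Suc i)" using top_pattern_step[OF ik] by simp
qed (auto simp: top_pattern_def)

lemma top_patternI:
  assumes \<Lambda>: "\<Lambda> \<in> P" and step: "\<And>k i. i < k \<Longrightarrow> k < n \<Longrightarrow> \<Lambda> (k, i) + 1 = \<Lambda> (Suc k, Suc i)"
  shows "\<Lambda> = top_pattern"
proof -
  have "\<Lambda> (k, i) = top_pattern (k, i)" if "k \<le> n" "i < k" for k i
    using that
  proof (induction k arbitrary: i rule: inc_induct)
    case base
    then show ?case using gt_patternsD(2)[OF \<Lambda>] gt_patternsD(2)[OF top_pattern_in_P] by simp
  next
    case (step k)
    then show ?case using assms(2)[of i k] top_pattern_step[of i k] step.IH[of "Suc i"] by simp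
  qed
  then show ?thesis
    using gt_patternsD(1)[OF \<Lambda>] gt_patternsD(1)[OF top_pattern_in_P] by (auto simp: fun_eq_iff) metis
qed

lemma weight_top_pattern:
  assumes "k < n"
  shows "weight top_pattern k = x (n - Suc k) - int (n - Suc k)"
proof -
  have "row_sum top_pattern (Suc k) = top_pattern (Suc k, 0) + (\<Sum>i<k. top_pattern (Suc k, Suc i) - int (Suc i))"
    unfolding row_sum_def by (subst sum.lessThan_Suc_shift) simp
  also have "(\<Sum>i<k. top_pattern (Suc k, Suc i) - int (Suc i)) = row_sum top_pattern k"
    unfolding row_sum_def
  proof (intro sum.cong refl)
    fix i assume "i \<in> {..<k}"
    then show "top_pattern (Suc k, Suc i) - int (Suc i) = top_pattern (k, i) - int i"
      using top_pattern_step[of i k] assms by simp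
  qed
  finally show ?thesis using assms by (simp add: weight_def top_pattern_def)
qed

definition top_vec :: "(nat \<times> nat \<Rightarrow> int) \<Rightarrow> complex" where
  "top_vec \<Lambda> = (if \<Lambda> = top_pattern then 1 else 0)"

lemma supported_top_vec: "supported top_vec"
  using top_pattern_in_P by (auto simp: supported_def top_vec_def)

lemma bump_top_pattern_notin_P:
  assumes "Suc k < n" "i \<le> k"
  shows "bump top_pattern (Suc k) i \<notin> P"
  using bump_in_P_iff[OF top_pattern_in_P assms] top_pattern_step[of i "Suc k"] assms by auto

lemma raise_top_vec: "Suc k < n \<Longrightarrow> raise a k top_vec = (\<lambda>_. 0)"
proof
  fix \<Lambda> assume k: "Suc k < n"
  have "drop_at \<Lambda> (Suc k) i \<noteq> top_pattern" if "\<Lambda> \<in> P" "i \<le> k" for i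
    using bump_top_pattern_notin_P[OF k that(2)] that(1) bump_drop_at(1)[of \<Lambda> "Suc k" i] by metis
  then show "raise a k top_vec \<Lambda> = 0" by (simp add: raise_def top_vec_def)
qed

lemma lower_top: "Suc k < n \<Longrightarrow> supported c \<Longrightarrow> lower b k c top_pattern = 0"
  unfolding lower_def supported_def using bump_top_pattern_notin_P by (auto intro!: sum.neutral)

lemma diag_top_vec: "k < n \<Longrightarrow> diag k top_vec = (\<lambda>\<Lambda>. of_int (x (n - Suc k) - int (n - Suc k)) * top_vec \<Lambda>)"
  by (auto simp: diag_def top_vec_def weight_top_pattern)

text \<open>
  By induction on \<open>k\<close>, the rows below \<open>k\<close> of each pattern in the support of \<open>c\<close> are as large as
  the row \<open>k\<close> permits.  If then row \<open>k\<close> has an entry \<open>i\<close> that could be raised below row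
  \<open>Suc k\<close>, the raised array is a pattern, and \<open>\<Lambda>\<close> is the only pattern of the support
  from which a raising step leads to it, because the unchanged row below determines the place of the step.
  So the coefficient of \<open>c\<close> at \<open>\<Lambda>\<close> vanishes.
\<close>

lemma raise_zero_imp_top:
  assumes a: "\<And>k i \<Lambda>. Suc k < n \<Longrightarrow> i \<le> k \<Longrightarrow> \<Lambda> \<in> P \<Longrightarrow> bump \<Lambda> (Suc k) i \<in> P \<Longrightarrow> a k i \<Lambda> \<noteq> 0"
    and c: "supported c" and zero: "\<And>k. Suc k < n \<Longrightarrow> raise a k c = (\<lambda>_. 0)"
    and "c \<Lambda> \<noteq> 0"
  shows "\<Lambda> = top_pattern"
proof -
  have "\<forall>\<Lambda>. c \<Lambda> \<noteq> 0 \<longrightarrow> (\<forall>l<k. \<forall>i<l. \<Lambda> (l, i) + 1 = \<Lambda> (Suc l, Suc i))" if "k \<le> n" for k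
    using that
  proof (induction k)
    case (Suc k)
    show ?case
    proof (intro allI impI)
      fix \<Lambda> l i assume nz: "c \<Lambda> \<noteq> 0" and l: "l < Suc k" and i: "i < l"
      have below: "M (l, j) + 1 = M (Suc l, Suc j)" if "c M \<noteq> 0" "l < k" "j < l" for M l j
        using Suc that by auto
      show "\<Lambda> (l, i) + 1 = \<Lambda> (Suc l, Suc i)"
      proof (cases "l < k")
        case True
        then show ?thesis using below nz i by blast
      next
        case False
        then have "l = k" using l by simp
        then obtain m where m: "l = Suc m" "k = Suc m" using i by (cases l) auto
        have \<Lambda>: "\<Lambda> \<in> P" using nz c by (auto simp: supported_def)
        have mn: "Suc m < n" and im: "i \<le> m" using Suc.prems m i by auto
        show ?thesis
        proof (rule ccontr)
          assume "\<Lambda> (l, i) + 1 \<noteq> \<Lambda> (Suc l, Suc i)"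
          then have lt: "\<Lambda> (Suc m, i) + 1 < \<Lambda> (Suc (Suc m), Suc i)"
            using gt_patternsD(4)[OF \<Lambda>, of i l] mn i m by simp
          have "\<Lambda> (Suc m, i) < \<Lambda> (m, i)" if "i < m"
            using below[OF nz, of m i] gt_patternsD(3)[OF \<Lambda>, of "Suc i" "Suc m"] that lt m mn by simp
          then have B: "bump \<Lambda> (Suc m) i \<in> P" using bump_in_P_iff[OF \<Lambda> mn im] lt by simp
          let ?B = "bump \<Lambda> (Suc m) i"
          \<comment> \<open>Comparing row \<open>m\<close> with the next row in \<open>\<Lambda>\<close> and in \<open>drop_at ?B (Suc m) j\<close> shows \<open>j = i\<close>.\<close>
          have others: "c (drop_at ?B (Suc m) j) = 0" if j: "j \<le> m" "j \<noteq> i" for j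
          proof (rule ccontr)
            assume c0: "c (drop_at ?B (Suc m) j) \<noteq> 0"
            show False
            proof (cases "i = 0")
              case True
              then obtain j' where j': "j = Suc j'" using j by (cases j) auto
              then show False
                using below[OF c0, of m j'] below[OF nz, of m j'] j m True
                by (auto simp: drop_at_def bump_def)
            next
              case False
              then obtain i' where i': "i = Suc i'" by (cases i) auto
              then show False
                using below[OF c0, of m i'] below[OF nz, of m i'] j m im
                by (auto simp: drop_at_def bump_def)
            qed
          qed
          have "raise a m c ?B = (\<Sum>j\<le>m. a m j (drop_at ?B (Suc m) j) * c (drop_at ?B (Suc m) j))"
            using B by (simp add: raise_def)
          also have "\<dots> = (\<Sum>j\<le>m. if j = i then a m i \<Lambda> * c \<Lambda> else 0)"
            by (intro sum.cong refl) (use others in auto)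
          also have "\<dots> = a m i \<Lambda> * c \<Lambda>" using im by simp
          finally show False using zero[OF mn] a[OF mn im \<Lambda> B] nz by simp
        qed
      qed
    qed
  qed simp
  from this[of n] assms(4) have "\<Lambda> (k, i) + 1 = \<Lambda> (Suc k, Suc i)" if "i < k" "k < n" for k i
    using that by blast
  moreover have "\<Lambda> \<in> P" using assms(4) c by (auto simp: supported_def)
  ultimately show ?thesis by (intro top_patternI)
qed

text \<open>
  Each raising step increases the sum of the entries, which is bounded on the finite set of patterns,
  so repeated raising must reach a nonzero vector on which all raising operators vanish.
\<close>

lemma singular_vector_exists:
  assumes K: "\<And>c. c \<in> K \<Longrightarrow> supported c" "\<And>c k. c \<in> K \<Longrightarrow> Suc k < n \<Longrightarrow> raise a k c \<in> K"
    and c: "c \<in> K" "c \<noteq> (\<lambda>_. 0)"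
  shows "\<exists>c\<in>K. c \<noteq> (\<lambda>_. 0) \<and> (\<forall>k. Suc k < n \<longrightarrow> raise a k c = (\<lambda>_. 0))"
proof -
  define size where "size \<Lambda> = (\<Sum>k\<le>n. row_sum \<Lambda> k)" for \<Lambda>
  have size_bump: "size (bump \<Lambda> (Suc k) i) = size \<Lambda> + 1" if "Suc k < n" "i \<le> k" for \<Lambda> k i
    using that by (simp add: size_def row_sum_bump sum.distrib)
  obtain B where B: "size \<Lambda> < B" if "\<Lambda> \<in> P" for \<Lambda>
    using finite_P by (metis finite_imageI image_eqI finite_nat_set_iff_bounded Max_ge zle_add1_eq_le)
  \<comment> \<open>Induction on \<open>d\<close>, which bounds the distance of the entry sums in the support from the upper bound \<open>B\<close>.\<close>
  have climb: "\<exists>c\<in>K. c \<noteq> (\<lambda>_. 0) \<and> (\<forall>k. Suc k < n \<longrightarrow> raise a k c = (\<lambda>_. 0))"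
    if "c \<in> K" "c \<noteq> (\<lambda>_. 0)" "\<And>\<Lambda>. c \<Lambda> \<noteq> 0 \<Longrightarrow> B \<le> size \<Lambda> + int d" for c d
    using that
  proof (induction d arbitrary: c)
    case 0
    then obtain \<Lambda> where "c \<Lambda> \<noteq> 0" by auto
    then show ?case using 0 B[of \<Lambda>] K(1)[of c] by (force simp: supported_def)
  next
    case (Suc d)
    show ?case
    proof (cases "\<forall>k. Suc k < n \<longrightarrow> raise a k c = (\<lambda>_. 0)")
      case False
      then obtain k where k: "Suc k < n" "raise a k c \<noteq> (\<lambda>_. 0)" by auto
      show ?thesis
      proof (rule Suc.IH[OF K(2)[OF Suc.prems(1) k(1)] k(2)])
        fix \<Lambda> assume "raise a k c \<Lambda> \<noteq> 0"
        then obtain i where i: "i \<le> k" "c (drop_at \<Lambda> (Suc k) i) \<noteq> 0"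
          by (auto simp: raise_def split: if_splits elim!: sum.not_neutral_contains_not_neutral)
        then show "B \<le> size \<Lambda> + int d"
          using Suc.prems(3)[OF i(2)] size_bump[OF k(1) i(1), of "drop_at \<Lambda> (Suc k) i"] by simp
      qed
    qed (use Suc.prems in blast)
  qed
  show ?thesis
  proof (rule climb[OF c])
    fix \<Lambda> assume "c \<Lambda> \<noteq> 0"
    then have "\<Lambda> \<in> P" using K(1)[OF c(1)] by (auto simp: supported_def)
    then have "Min (size ` P) \<le> size \<Lambda>" using finite_P by simp
    then show "B \<le> size \<Lambda> + int (nat (B - Min (size ` P)))" by simp
  qed
qed

lemma top_supported_vector_exists:
  assumes a: "\<And>k i \<Lambda>. Suc k < n \<Longrightarrow> i \<le> k \<Longrightarrow> \<Lambda> \<in> P \<Longrightarrow> bump \<Lambda> (Suc k) i \<in> P \<Longrightarrow> a k i \<Lambda> \<noteq> 0"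
    and K: "\<And>c. c \<in> K \<Longrightarrow> supported c" "\<And>c k. c \<in> K \<Longrightarrow> Suc k < n \<Longrightarrow> raise a k c \<in> K"
    and c: "c \<in> K" "c \<noteq> (\<lambda>_. 0)"
  shows "\<exists>z. z \<noteq> 0 \<and> (\<lambda>\<Lambda>. z * top_vec \<Lambda>) \<in> K"
proof -
  obtain d where d: "d \<in> K" "d \<noteq> (\<lambda>_. 0)" "\<And>k. Suc k < n \<Longrightarrow> raise a k d = (\<lambda>_. 0)"
    using singular_vector_exists[of K a c] K c by blast
  have top: "\<Lambda> = top_pattern" if "d \<Lambda> \<noteq> 0" for \<Lambda>
    using raise_zero_imp_top[of a d \<Lambda>] a K(1)[OF d(1)] d(3) that by blast
  have "d = (\<lambda>\<Lambda>. d top_pattern * top_vec \<Lambda>)"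
  proof
    show "d \<Lambda> = d top_pattern * top_vec \<Lambda>" for \<Lambda>
      using top[of \<Lambda>] by (cases "\<Lambda> = top_pattern") (auto simp: top_vec_def)
  qed
  moreover have "d top_pattern \<noteq> 0" using d(2) top by (metis ext)
  ultimately show ?thesis using d(1) by metis
qed

lemma sum_mult_lower:
  assumes c: "supported c" and d: "supported d"
  assumes k: "Suc k < n"
  shows "(\<Sum>\<Lambda>\<in>P. c \<Lambda> * lower b k d \<Lambda>) = (\<Sum>\<Lambda>\<in>P. raise b k c \<Lambda> * d \<Lambda>)"
proof -
  have "(\<Sum>\<Lambda>\<in>P. c \<Lambda> * lower b k d \<Lambda>) = (\<Sum>\<Lambda>\<in>P. \<Sum>i\<le>k. c \<Lambda> * b k i \<Lambda> * d (bump \<Lambda> (Suc k) i))"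
    by (simp add: lower_def sum_distrib_left mult.assoc)
  also have "\<dots> = (\<Sum>i\<le>k. \<Sum>\<Lambda>\<in>P. c \<Lambda> * b k i \<Lambda> * d (bump \<Lambda> (Suc k) i))"
    by (rule sum.swap)
  also have "\<dots> = (\<Sum>i\<le>k. \<Sum>\<Lambda>\<in>P. b k i (drop_at \<Lambda> (Suc k) i) * c (drop_at \<Lambda> (Suc k) i) * d \<Lambda>)"
  proof (rule sum.cong[OF refl])
    fix i
    have "(\<Sum>\<Lambda>\<in>P. c \<Lambda> * b k i \<Lambda> * d (bump \<Lambda> (Suc k) i)) =
      (\<Sum>\<Lambda> | \<Lambda> \<in> P \<and> bump \<Lambda> (Suc k) i \<in> P. c \<Lambda> * b k i \<Lambda> * d (bump \<Lambda> (Suc k) i))"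
      using d finite_P by (intro sum.mono_neutral_right) (auto simp: supported_def)
    also have "\<dots> = (\<Sum>\<Lambda> | \<Lambda> \<in> P \<and> drop_at \<Lambda> (Suc k) i \<in> P.
        b k i (drop_at \<Lambda> (Suc k) i) * c (drop_at \<Lambda> (Suc k) i) * d \<Lambda>)"
      by (rule sum.reindex_bij_witness[of _ "\<lambda>\<Lambda>. drop_at \<Lambda> (Suc k) i" "\<lambda>\<Lambda>. bump \<Lambda> (Suc k) i"]) auto
    also have "\<dots> = (\<Sum>\<Lambda>\<in>P. b k i (drop_at \<Lambda> (Suc k) i) * c (drop_at \<Lambda> (Suc k) i) * d \<Lambda>)"
      using c finite_P by (intro sum.mono_neutral_left) (auto simp: supported_def)
    finally show "(\<Sum>\<Lambda>\<in>P. c \<Lambda> * b k i \<Lambda> * d (bump \<Lambda> (Suc k) i)) =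
      (\<Sum>\<Lambda>\<in>P. b k i (drop_at \<Lambda> (Suc k) i) * c (drop_at \<Lambda> (Suc k) i) * d \<Lambda>)" .
  qed
  also have "\<dots> = (\<Sum>\<Lambda>\<in>P. \<Sum>i\<le>k. b k i (drop_at \<Lambda> (Suc k) i) * c (drop_at \<Lambda> (Suc k) i) * d \<Lambda>)"
    by (rule sum.swap)
  also have "\<dots> = (\<Sum>\<Lambda>\<in>P. raise b k c \<Lambda> * d \<Lambda>)"
    by (simp add: raise_def sum_distrib_right)
  finally show ?thesis .
qed

end

section \<open>Submodules for the general linear Lie algebra\<close>

lemma matrix_unit_carrier [simp]: "matrix_unit n i j \<in> carrier_mat n n"
  by (simp add: matrix_unit_def)

lemma matrix_unit_mult:
  assumes "i < n" "j < n" "k < n" "l < n"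
  shows "matrix_unit n i j * matrix_unit n k l = (if j = k then matrix_unit n i l else 0\<^sub>m n n)"
proof (rule eq_matI)
  fix a b assume ab: "a < dim_row (if j = k then matrix_unit n i l else 0\<^sub>m n n)"
    "b < dim_col (if j = k then matrix_unit n i l else 0\<^sub>m n n)"
  then have ab: "a < n" "b < n" by (auto simp: matrix_unit_def split: if_splits)
  have "(matrix_unit n i j * matrix_unit n k l) $$ (a, b) =
      (\<Sum>c<n. (if a = i \<and> c = j then 1 else 0) * (if c = k \<and> b = l then 1 else 0))"
    using ab by (simp add: matrix_unit_def scalar_prod_def atLeast0LessThan)
  also have "\<dots> = (\<Sum>c<n. if c = j then (if a = i \<and> j = k \<and> b = l then 1 else 0) else 0)"
    by (intro sum.cong) auto
  also have "\<dots> = (if j = k then matrix_unit n i l else 0\<^sub>m n n) $$ (a, b)"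
    using assms ab by (auto simp: matrix_unit_def)
  finally show "(matrix_unit n i j * matrix_unit n k l) $$ (a, b) =
    (if j = k then matrix_unit n i l else 0\<^sub>m n n) $$ (a, b)" .
qed (auto simp: matrix_unit_def)

context gl_module
begin

lemma act_vec_add: "X \<in> carrier_mat n n \<Longrightarrow> act X (v + w) = act X v + act X w"
  and act_vec_scale: "X \<in> carrier_mat n n \<Longrightarrow> act X (scale c v) = scale c (act X v)"
  using act_linear by (auto simp: Vector_Spaces.linear_iff)

lemma act_vec_zero: "X \<in> carrier_mat n n \<Longrightarrow> act X 0 = 0"
  using act_vec_scale[of X 0 0] by simp

lemma act_vec_diff: "X \<in> carrier_mat n n \<Longrightarrow> act X (v - w) = act X v - act X w"
  using act_vec_add[of X "v - w" w] by (simp add: algebra_simps)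

lemma act_zero: "act (0\<^sub>m n n) v = 0"
proof -
  have "0\<^sub>m n n = 0 \<cdot>\<^sub>m (0\<^sub>m n n :: complex mat)" by auto
  then show ?thesis using act_smult[of "0\<^sub>m n n" 0 v] by simp
qed

lemma act_diff:
  assumes "X \<in> carrier_mat n n" "Y \<in> carrier_mat n n"
  shows "act (X - Y) v = act X v - act Y v"
proof -
  have "X - Y = X + (- 1) \<cdot>\<^sub>m Y" using assms by (intro eq_matI) auto
  then show ?thesis using act_add[of X "(- 1) \<cdot>\<^sub>m Y" v] act_smult[of Y "- 1" v] assms by simp
qed

lemma act_matrix_unit_commute:
  assumes "i < n" "j < n" "k < n" "l < n"
  shows "act (matrix_unit n i j) (act (matrix_unit n k l) w) =
    act (matrix_unit n k l) (act (matrix_unit n i j) w) +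
    (if j = k then act (matrix_unit n i l) w else 0) - (if l = i then act (matrix_unit n k j) w else 0)"
proof -
  have "act (matrix_unit n i j * matrix_unit n k l - matrix_unit n k l * matrix_unit n i j) w =
    (if j = k then act (matrix_unit n i l) w else 0) - (if l = i then act (matrix_unit n k j) w else 0)"
    using assms by (subst act_diff) (auto simp: matrix_unit_mult act_zero)
  then show ?thesis
    using act_bracket[of "matrix_unit n i j" "matrix_unit n k l" w] by (simp add: algebra_simps)
qed

lemma submodule_if_matrix_unit_closed:
  assumes W: "subspace W" and unit: "\<And>i j w. i < n \<Longrightarrow> j < n \<Longrightarrow> w \<in> W \<Longrightarrow> act (matrix_unit n i j) w \<in> W"
  shows "submodule W"
  unfolding submodule_def
proof (intro conjI ballI W)
  fix X :: "complex mat" and w assume X: "X \<in> carrier_mat n n" and w: "w \<in> W"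
  \<comment> \<open>The part of \<open>X\<close> supported on \<open>S\<close>, for induction over the matrix entries.\<close>
  define part where "part S = mat n n (\<lambda>p. if p \<in> S then X $$ p else 0)" for S
  have "act (part S) w \<in> W" if "finite S" "S \<subseteq> {..<n} \<times> {..<n}" for S
    using that
  proof (induction S rule: finite_induct)
    case empty
    have "part {} = 0\<^sub>m n n" by (auto simp: part_def)
    then show ?case using act_zero subspace_0[OF W] by simp
  next
    case (insert p S)
    obtain i j where p: "p = (i, j)" by force
    have "part (insert p S) = part S + X $$ (i, j) \<cdot>\<^sub>m matrix_unit n i j"
      using insert.hyps p by (intro eq_matI) (auto simp: part_def matrix_unit_def)
    then have "act (part (insert p S)) w = act (part S) w + scale (X $$ (i, j)) (act (matrix_unit n i j) w)"
      by (simp add: act_add act_smult part_def)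
    then show ?case
      using insert p w by (auto intro!: subspace_add[OF W] subspace_scale[OF W] unit)
  qed
  moreover have "part ({..<n} \<times> {..<n}) = X" using X by (intro eq_matI) (auto simp: part_def)
  ultimately show "act X w \<in> W" by (metis finite_SigmaI finite_lessThan subset_refl)
qed

text \<open>
  The matrix units next to the diagonal generate the Lie algebra, as
  \<open>E (i, j + 1)\<close> is the commutator of \<open>E (i, j)\<close> and \<open>E (j, j + 1)\<close> for \<open>i < j\<close>, and
  likewise below the diagonal.
\<close>

lemma submodule_if_Chevalley_closed:
  assumes W: "subspace W"
    and up: "\<And>k w. Suc k < n \<Longrightarrow> w \<in> W \<Longrightarrow> act (matrix_unit n k (Suc k)) w \<in> W"
    and down: "\<And>k w. Suc k < n \<Longrightarrow> w \<in> W \<Longrightarrow> act (matrix_unit n (Suc k) k) w \<in> W"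
    and diag: "\<And>k w. k < n \<Longrightarrow> w \<in> W \<Longrightarrow> act (matrix_unit n k k) w \<in> W"
  shows "submodule W"
proof (rule submodule_if_matrix_unit_closed[OF W])
  have above: "act (matrix_unit n i (Suc (i + d))) w \<in> W" if "Suc (i + d) < n" "w \<in> W" for i d w
    using that
  proof (induction d arbitrary: w)
    case (Suc d)
    let ?A = "matrix_unit n i (Suc (i + d))" and ?B = "matrix_unit n (Suc (i + d)) (Suc (i + Suc d))"
    have "act (matrix_unit n i (Suc (i + Suc d))) w = act ?A (act ?B w) - act ?B (act ?A w)"
      using Suc.prems by (subst act_matrix_unit_commute) auto
    then show ?case using Suc up[of "Suc (i + d)"] by (auto intro!: subspace_diff[OF W])
  qed (use up in simp)
  have below: "act (matrix_unit n (Suc (i + d)) i) w \<in> W" if "Suc (i + d) < n" "w \<in> W" for i d w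
    using that
  proof (induction d arbitrary: w)
    case (Suc d)
    let ?A = "matrix_unit n (Suc (i + d)) i" and ?B = "matrix_unit n (Suc (i + Suc d)) (Suc (i + d))"
    have "act (matrix_unit n (Suc (i + Suc d)) i) w = act ?B (act ?A w) - act ?A (act ?B w)"
      using Suc.prems by (subst act_matrix_unit_commute) auto
    then show ?case using Suc down[of "Suc (i + d)"] by (auto intro!: subspace_diff[OF W])
  qed (use down in simp)
  fix i j w assume ij: "i < n" "j < n" and w: "w \<in> W"
  show "act (matrix_unit n i j) w \<in> W"
  proof (cases i j rule: linorder_cases)
    case less
    then show ?thesis using above[of i "j - i - 1" w] ij w by simp
  next
    case greater
    then show ?thesis using below[of j "i - j - 1" w] ij w by simp
  qed (use diag ij w in simp)
qed

end

section \<open>The dimension of a simple highest weight module\<close>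

text \<open>
  The duality between subspaces of a finite-dimensional coordinate space and their annihilators, proved
  by elimination of one coordinate after the other.
\<close>

lemma annihilator_trivial_imp_all:
  fixes S :: "('i \<Rightarrow> 'a::field) set"
  assumes "finite A"
    and "\<And>b b'. b \<in> S \<Longrightarrow> b' \<in> S \<Longrightarrow> (\<lambda>i. b i + b' i) \<in> S"
    and "\<And>b z. b \<in> S \<Longrightarrow> (\<lambda>i. z * b i) \<in> S"
    and "(\<lambda>_. 0) \<in> S"
    and "\<And>c. (\<And>b. b \<in> S \<Longrightarrow> (\<Sum>i\<in>A. c i * b i) = 0) \<Longrightarrow> \<forall>i\<in>A. c i = 0"
  shows "\<exists>b\<in>S. \<forall>i\<in>A. b i = g i"
  using assms
proof (induction A arbitrary: S g rule: finite_induct)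
  case empty
  then show ?case by auto
next
  case (insert a A)
  note add = insert.prems(1) and scale = insert.prems(2) and zero = insert.prems(3)
    and ann = insert.prems(4)
  have "\<exists>b\<in>S. b a \<noteq> 0"
  proof (rule ccontr)
    assume *: "\<not> (\<exists>b\<in>S. b a \<noteq> 0)"
    have "\<forall>i\<in>insert a A. (if i = a then 1 else 0 :: 'a) = 0"
    proof (rule ann)
      fix b assume "b \<in> S"
      then show "(\<Sum>i\<in>insert a A. (if i = a then 1 else 0) * b i) = 0"
        using * by (intro sum.neutral) auto
    qed
    then show False by auto
  qed
  then obtain b1 where b1: "b1 \<in> S" "b1 a \<noteq> 0" by auto
  \<comment> \<open>\<open>b0\<close> is the pivot: it eliminates coordinate \<open>a\<close> from all other elements of \<open>S\<close>.\<close>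
  define b0 where "b0 i = inverse (b1 a) * b1 i" for i
  have b0: "b0 \<in> S" "b0 a = 1" using scale[OF b1(1), of "inverse (b1 a)"] b1 by (simp_all add: b0_def[abs_def])
  have IH: "\<exists>b\<in>{b\<in>S. b a = 0}. \<forall>i\<in>A. b i = h i" for h
  proof (rule insert.IH)
    fix c assume c: "\<And>b. b \<in> {b\<in>S. b a = 0} \<Longrightarrow> (\<Sum>i\<in>A. c i * b i) = 0"
    \<comment> \<open>The value at \<open>a\<close> is chosen to make \<open>c'\<close> orthogonal to the pivot.\<close>
    define c' where "c' i = (if i = a then - (\<Sum>i\<in>A. c i * b0 i) else c i)" for i
    have "\<forall>i\<in>insert a A. c' i = 0"
    proof (rule ann)
      fix b assume b: "b \<in> S"
      have "(\<lambda>i. b i + (- b a) * b0 i) \<in> {b\<in>S. b a = 0}"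
        using add[OF b scale[OF b0(1), of "- b a"]] b0(2) by simp
      from c[OF this] have "(\<Sum>i\<in>A. c i * b i) = b a * (\<Sum>i\<in>A. c i * b0 i)"
        by (simp add: algebra_simps sum_subtractf sum_distrib_left)
      moreover have "(\<Sum>i\<in>A. c' i * b i) = (\<Sum>i\<in>A. c i * b i)"
        using insert.hyps by (intro sum.cong) (auto simp: c'_def)
      ultimately show "(\<Sum>i\<in>insert a A. c' i * b i) = 0"
        using insert.hyps by (simp add: c'_def)
    qed
    then show "\<forall>i\<in>A. c i = 0" using insert.hyps by (auto simp: c'_def split: if_splits)
  qed (use add scale zero in auto)
  then obtain b where b: "b \<in> S" "b a = 0" "\<forall>i\<in>A. b i = g i - g a * b0 i"
    using IH[of "\<lambda>i. g i - g a * b0 i"] by blast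
  have "(\<lambda>i. b i + g a * b0 i) \<in> S" using add[OF b(1) scale[OF b0(1)]] .
  then show ?case using b b0(2) by (intro bexI[of _ "\<lambda>i. b i + g a * b0 i"]) auto
qed

locale fd_simple_gl_module_highest_weight = fd_simple_gl_module scale n act
  for scale :: "complex \<Rightarrow> 'v::ab_group_add \<Rightarrow> 'v" and n act +
  fixes \<pi> :: "nat \<Rightarrow> nat" and v0 :: 'v
  assumes v0_nonzero: "v0 \<noteq> 0"
    and v0_singular: "Suc k < n \<Longrightarrow> act (matrix_unit n k (Suc k)) v0 = 0"
    and v0_weight: "k < n \<Longrightarrow> act (matrix_unit n k k) v0 = scale (of_nat (\<pi> k)) v0"
    and weight_decreasing: "Suc k < n \<Longrightarrow> \<pi> (Suc k) \<le> \<pi> k"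
begin

sublocale gt: gelfand_tsetlin n "\<lambda>i. int (\<pi> (n - Suc i)) + int i"
proof
  fix i assume i: "Suc i < n"
  then have "n - Suc i = Suc (n - Suc (Suc i))" by simp
  then show "int (\<pi> (n - Suc i)) + int i < int (\<pi> (n - Suc (Suc i))) + int (Suc i)"
    using weight_decreasing[of "n - Suc (Suc i)"] i by simp
qed

abbreviation e :: "nat \<Rightarrow> 'v \<Rightarrow> 'v" where "e k \<equiv> act (matrix_unit n k (Suc k))"
abbreviation f :: "nat \<Rightarrow> 'v \<Rightarrow> 'v" where "f k \<equiv> act (matrix_unit n (Suc k) k)"
abbreviation h :: "nat \<Rightarrow> 'v \<Rightarrow> 'v" where "h k \<equiv> act (matrix_unit n k k)"

abbreviation E where "E \<equiv> gt.raise up_coef"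
abbreviation F where "F \<equiv> gt.lower down_coef"

text \<open>
  The smallest linear relation that contains the pair of highest weight vectors and is stable under the
  lowering operators.  It will turn out to be an isomorphism between the module and the pattern space.
\<close>

inductive graph :: "'v \<Rightarrow> ((nat \<times> nat \<Rightarrow> int) \<Rightarrow> complex) \<Rightarrow> bool" where
  graph_top: "graph v0 gt.top_vec"
| graph_add: "graph a b \<Longrightarrow> graph a' b' \<Longrightarrow> graph (a + a') (\<lambda>\<Lambda>. b \<Lambda> + b' \<Lambda>)"
| graph_scale: "graph a b \<Longrightarrow> graph (scale z a) (\<lambda>\<Lambda>. z * b \<Lambda>)"
| graph_f: "graph a b \<Longrightarrow> Suc k < n \<Longrightarrow> graph (f k a) (F k b)"

lemma graph_zero: "graph 0 (\<lambda>_. 0)"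
  using graph_scale[OF graph_top, of 0] by simp

lemma graph_diff:
  assumes "graph a b" "graph a' b'"
  shows "graph (a - a') (\<lambda>\<Lambda>. b \<Lambda> - b' \<Lambda>)"
  using graph_add[OF assms(1) graph_scale[OF assms(2), of "- 1"]] by simp

lemma graph_sum:
  "finite I \<Longrightarrow> (\<And>i. i \<in> I \<Longrightarrow> graph (a i) (b i)) \<Longrightarrow> graph (\<Sum>i\<in>I. a i) (\<lambda>\<Lambda>. \<Sum>i\<in>I. b i \<Lambda>)"
  by (induction I rule: finite_induct) (auto intro: graph_zero graph_add)

lemma graph_supported: "graph a b \<Longrightarrow> gt.supported b"
  by (induction rule: graph.induct)
    (auto simp: gt.supported_top_vec gt.supported_lower, auto simp: gt.supported_def)

lemma graph_h:
  assumes "graph a b" and l: "l < n"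
  shows "graph (h l a) (gt.diag l b)"
  using assms(1)
proof (induction rule: graph.induct)
  case graph_top
  have "n - Suc (n - Suc l) = l" using l by simp
  then show ?case
    using graph_scale[OF graph.graph_top, of "of_nat (\<pi> l)"] l
    by (simp add: v0_weight gt.diag_top_vec)
next
  case (graph_add a b a' b')
  have "gt.diag l (\<lambda>\<Lambda>. b \<Lambda> + b' \<Lambda>) = (\<lambda>\<Lambda>. gt.diag l b \<Lambda> + gt.diag l b' \<Lambda>)"
    by (auto simp: gt.diag_def algebra_simps)
  then show ?case using graph.graph_add[OF graph_add.IH] by (simp add: act_vec_add)
next
  case (graph_scale a b z)
  have "gt.diag l (\<lambda>\<Lambda>. z * b \<Lambda>) = (\<lambda>\<Lambda>. z * gt.diag l b \<Lambda>)"
    by (auto simp: gt.diag_def algebra_simps)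
  then show ?case using graph.graph_scale[OF graph_scale.IH] by (simp add: act_vec_scale)
next
  case (graph_f a b k)
  let ?z = "(if l = Suc k then 1 else 0) - (if l = k then 1 else 0) :: complex"
  have "h l (f k a) = f k (h l a) + scale ?z (f k a)"
    using graph_f.hyps l by (subst act_matrix_unit_commute) auto
  moreover have "gt.diag l (F k b) = (\<lambda>\<Lambda>. F k (gt.diag l b) \<Lambda> + ?z * F k b \<Lambda>)"
    by (rule ext) (rule gt.diag_lower)
  ultimately show ?case
    using graph.graph_add[OF graph.graph_f[OF graph_f.IH graph_f.hyps(2)]
        graph.graph_scale[OF graph.graph_f[OF graph_f.hyps], of ?z]] by simp
qed

lemma graph_e:
  assumes "graph a b" and k: "Suc k < n"
  shows "graph (e k a) (E k b)"
  using assms(1)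
proof (induction rule: graph.induct)
  case graph_top
  then show ?case using k graph_zero by (simp add: v0_singular gt.raise_top_vec)
next
  case (graph_add a b a' b')
  have "E k (\<lambda>\<Lambda>. b \<Lambda> + b' \<Lambda>) = (\<lambda>\<Lambda>. E k b \<Lambda> + E k b' \<Lambda>)"
    by (rule ext) (simp add: gt.raise_def distrib_left sum.distrib)
  then show ?case using graph.graph_add[OF graph_add.IH] by (simp add: act_vec_add)
next
  case (graph_scale a b z)
  have "E k (\<lambda>\<Lambda>. z * b \<Lambda>) = (\<lambda>\<Lambda>. z * E k b \<Lambda>)"
    by (rule ext) (simp add: gt.raise_def sum_distrib_left mult.left_commute)
  then show ?case using graph.graph_scale[OF graph_scale.IH] by (simp add: act_vec_scale)
next
  case (graph_f a b l)
  note supp = graph_supported[OF graph_f.hyps(1)]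
  have rel: "E k (F l b) \<Lambda> = F l (E k b) \<Lambda> + (if k = l then gt.diag k b \<Lambda> - gt.diag (Suc k) b \<Lambda> else 0)" for \<Lambda>
    using gt.raise_lower_commutator[OF supp k graph_f.hyps(2), of \<Lambda>] by (simp add: algebra_simps)
  note FE = graph.graph_f[OF graph_f.IH graph_f.hyps(2)]
  show ?case
  proof (cases "k = l")
    case True
    have "e k (f k a) = f k (e k a) + (h k a - h (Suc k) a)"
      using k by (subst act_matrix_unit_commute) auto
    moreover have "E k (F k b) = (\<lambda>\<Lambda>. F k (E k b) \<Lambda> + (gt.diag k b \<Lambda> - gt.diag (Suc k) b \<Lambda>))"
      using rel True by auto
    moreover have "graph (h k a - h (Suc k) a) (\<lambda>\<Lambda>. gt.diag k b \<Lambda> - gt.diag (Suc k) b \<Lambda>)"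
      using graph_diff graph_h graph_f.hyps(1) k by auto
    ultimately show ?thesis using graph.graph_add FE True by auto
  next
    case False
    then have "e k (f l a) = f l (e k a)"
      using k graph_f.hyps(2) by (subst act_matrix_unit_commute) auto
    moreover have "E k (F l b) = F l (E k b)" using rel False by auto
    ultimately show ?thesis using FE by simp
  qed
qed

text \<open>
  The action of the diagonal matrix with entries \<open>n, n - 1, \<dots>, 1\<close>.  Every lowering operator
  decreases its eigenvalue by one, so it grades the module by the distance from the highest weight
  vector.
\<close>

definition \<rho> :: "'v \<Rightarrow> 'v" where
  "\<rho> w = (\<Sum>k<n. scale (of_nat (n - k)) (h k w))"

lemma \<rho>_add: "\<rho> (w + w') = \<rho> w + \<rho> w'"
  and \<rho>_scale: "\<rho> (scale z w) = scale z (\<rho> w)"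
  by (simp_all add: \<rho>_def act_vec_add act_vec_scale scale_right_distrib sum.distrib
      scale_sum_right mult.commute)

lemma \<rho>_f:
  assumes k: "Suc k < n"
  shows "\<rho> (f k w) = f k (\<rho> w) - f k w"
proof -
  have f_sum: "f k (\<Sum>l\<in>I. g l) = (\<Sum>l\<in>I. f k (g l))" for g and I :: "nat set"
    by (induction I rule: infinite_finite_induct) (auto simp: act_vec_zero act_vec_add)
  have "\<rho> (f k w) = (\<Sum>l<n. scale (of_nat (n - l)) (f k (h l w)) +
      ((if l = Suc k then scale (of_nat (n - Suc k)) (f k w) else 0) -
       (if l = k then scale (of_nat (n - k)) (f k w) else 0)))"
    unfolding \<rho>_def
  proof (intro sum.cong refl)
    fix l assume "l \<in> {..<n}"
    then have "h l (f k w) = f k (h l w) + (if l = Suc k then f k w else 0) - (if l = k then f k w else 0)"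
      using k by (subst act_matrix_unit_commute) auto
    then show "scale (of_nat (n - l)) (h l (f k w)) = scale (of_nat (n - l)) (f k (h l w)) +
      ((if l = Suc k then scale (of_nat (n - Suc k)) (f k w) else 0) -
       (if l = k then scale (of_nat (n - k)) (f k w) else 0))"
      by (auto simp: scale_right_distrib scale_right_diff_distrib)
  qed
  also have "\<dots> = f k (\<rho> w) + (scale (of_nat (n - Suc k)) (f k w) - scale (of_nat (n - k)) (f k w))"
    using k by (simp add: \<rho>_def f_sum act_vec_scale sum.distrib sum_subtractf)
  also have "n - k = Suc (n - Suc k)" using k by simp
  finally show ?thesis by (simp add: scale_left_distrib)
qed

definition d0 :: complex where
  "d0 = (\<Sum>k<n. of_nat (n - k) * of_nat (\<pi> k))"

lemma \<rho>_v0: "\<rho> v0 = scale d0 v0"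
  by (simp add: \<rho>_def d0_def v0_weight scale_sum_left)

definition below :: "'v set" where
  "below = span {w. \<exists>k. \<rho> w = scale (d0 - of_nat (Suc k)) w}"

lemma below_f:
  assumes "w \<in> below" "Suc l < n"
  shows "f l w \<in> below"
  using assms(1) unfolding below_def
proof (induction rule: span_induct_alt)
  case base
  then show ?case by (simp add: act_vec_zero span_zero)
next
  case (step c x y)
  then obtain k where k: "\<rho> x = scale (d0 - of_nat (Suc k)) x" by auto
  have "\<rho> (f l x) = scale (d0 - of_nat (Suc k) - 1) (f l x)"
    by (simp only: \<rho>_f[OF assms(2)] k act_vec_scale matrix_unit_carrier scale_left_diff_distrib[of _ 1] scale_one)
  also have "d0 - of_nat (Suc k) - 1 = d0 - of_nat (Suc (Suc k))" by simp
  finally have "f l x \<in> span {w. \<exists>k. \<rho> w = scale (d0 - of_nat (Suc k)) w}"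
    by (intro span_base) blast
  then show ?case using step.IH by (auto simp: act_vec_add act_vec_scale intro!: span_add span_scale)
qed

text \<open>
  Eigenvectors for different eigenvalues are independent: for large \<open>K\<close> the product \<open>T K\<close> of
  the operators \<open>\<rho> - (d0 - j)\<close> with \<open>1 \<le> j \<le> K\<close> annihilates a given element of \<open>below\<close>,
  but it multiplies \<open>v0\<close> by a nonzero factorial.
\<close>

lemma v0_notin_below: "v0 \<notin> below"
proof
  assume v0: "v0 \<in> below"
  define T where "T = rec_nat (\<lambda>w. w) (\<lambda>K g w. g (\<rho> w - scale (d0 - of_nat (Suc K)) w))"
  have T: "T 0 w = w" "T (Suc K) w = T K (\<rho> w - scale (d0 - of_nat (Suc K)) w)" for K w
    by (simp_all add: T_def)
  have T_lin: "T K (scale z w + w') = scale z (T K w) + T K w'" for K z w w'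
  proof (induction K arbitrary: z w w')
    case (Suc K)
    have "\<rho> (scale z w + w') - scale (d0 - of_nat (Suc K)) (scale z w + w') =
      scale z (\<rho> w - scale (d0 - of_nat (Suc K)) w) + (\<rho> w' - scale (d0 - of_nat (Suc K)) w')"
      by (simp add: \<rho>_add \<rho>_scale scale_right_distrib scale_right_diff_distrib mult.commute)
    then show ?case by (simp only: T(2) Suc.IH)
  qed (simp add: T)
  have T_scale: "T K (scale z w) = scale z (T K w)" for K z w
    using T_lin[of K z w 0] T_lin[of K 1 0 0] by simp
  have T_eigen: "T K w = scale (\<Prod>j\<in>{1..K}. of_nat j - of_nat k) w" if "\<rho> w = scale (d0 - of_nat k) w" for K k w
  proof (induction K)
    case (Suc K)
    have "\<rho> w - scale (d0 - of_nat (Suc K)) w = scale (of_nat (Suc K) - of_nat k) w"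
      by (simp add: that flip: scale_left_diff_distrib)
    then show ?case by (simp only: T(2) T_scale Suc.IH) (simp add: mult.commute)
  qed (simp add: T)
  have "\<exists>K0. \<forall>K\<ge>K0. T K w = 0" if "w \<in> below" for w
    using that unfolding below_def
  proof (induction rule: span_induct_alt)
    case base
    then show ?case using T_scale[of _ 0 0] by simp
  next
    case (step c x y)
    then obtain k K0 where k: "\<rho> x = scale (d0 - of_nat (Suc k)) x" and K0: "\<forall>K\<ge>K0. T K y = 0" by auto
    have "T K x = 0" if "K \<ge> Suc k" for K
    proof -
      have "(\<Prod>j\<in>{1..K}. of_nat j - of_nat (Suc k) :: complex) = 0"
        using that by (intro prod_zero bexI[of _ "Suc k"]) auto
      then show ?thesis using T_eigen[OF k] by simp
    qed
    then show ?case using K0 by (intro exI[of _ "max K0 (Suc k)"]) (simp add: T_lin)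
  qed
  then obtain K where "T K v0 = 0" using v0 by blast
  moreover have "T K v0 = scale (\<Prod>j\<in>{1..K}. of_nat j) v0" using T_eigen[of v0 0 K] \<rho>_v0 by simp
  moreover have "(\<Prod>j\<in>{1..K}. of_nat j :: complex) \<noteq> 0" by simp
  ultimately show False using v0_nonzero by simp
qed

text \<open>
  This links the coordinate at the top pattern to the component of highest weight in \<open>V\<close>.  In
  particular the zero vector of \<open>V\<close> is not related to a nonzero multiple of \<open>top_vec\<close>.
\<close>

lemma graph_top_coordinate:
  "graph a b \<Longrightarrow> a - scale (b gt.top_pattern) v0 \<in> below"
proof (induction rule: graph.induct)
  case graph_top
  then show ?case by (simp add: gt.top_vec_def below_def span_zero)
next
  case (graph_add a b a' b')
  have eq: "a + a' - scale (b gt.top_pattern + b' gt.top_pattern) v0 =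
    (a - scale (b gt.top_pattern) v0) + (a' - scale (b' gt.top_pattern) v0)"
    by (simp add: scale_left_distrib)
  show ?case
    unfolding eq using graph_add.IH unfolding below_def by (rule span_add)
next
  case (graph_scale a b z)
  have eq: "scale z a - scale (z * b gt.top_pattern) v0 = scale z (a - scale (b gt.top_pattern) v0)"
    by (simp add: scale_right_diff_distrib)
  show ?case
    unfolding eq using graph_scale.IH unfolding below_def by (rule span_scale)
next
  case (graph_f a b k)
  let ?z = "b gt.top_pattern"
  have "\<rho> (f k v0) = scale (d0 - of_nat (Suc 0)) (f k v0)"
    using graph_f.hyps(2) by (simp add: \<rho>_f \<rho>_v0 act_vec_scale scale_left_diff_distrib)
  then have v: "f k v0 \<in> below" unfolding below_def by (intro span_base) blast
  have "f k (a - scale ?z v0) \<in> below" using below_f graph_f by blast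
  then have "f k (a - scale ?z v0) + scale ?z (f k v0) \<in> below"
    using v unfolding below_def by (intro span_add span_scale)
  then have "f k a \<in> below" by (simp add: act_vec_diff act_vec_scale)
  then show ?case
    using gt.lower_top[OF graph_f.hyps(2) graph_supported[OF graph_f.hyps(1)]] by simp
qed

text \<open>
  The vectors related to \<open>0\<close> are stable under the raising operators, so if there were a nonzero
  one, then a multiple of \<open>top_vec\<close> would be among them.
\<close>

lemma graph_zero_left:
  assumes "graph 0 b"
  shows "b = (\<lambda>_. 0)"
proof (rule ccontr)
  assume "b \<noteq> (\<lambda>_. 0)"
  then obtain z where z: "z \<noteq> 0" "graph 0 (\<lambda>\<Lambda>. z * gt.top_vec \<Lambda>)"
    using gt.top_supported_vector_exists[of up_coef "{b. graph 0 b}" b]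
      gt.up_coef_nonzero graph_supported graph_e[of 0] assms by (auto simp: act_vec_zero)
  have "scale (- z) v0 \<in> below"
    using graph_top_coordinate[OF z(2)] by (simp add: gt.top_vec_def)
  then have "scale (inverse (- z)) (scale (- z) v0) \<in> below"
    unfolding below_def by (rule span_scale)
  then show False using v0_notin_below z(1) by simp
qed

lemma graph_unique_right:
  assumes "graph a b" "graph a b'"
  shows "b = b'"
proof -
  have diff: "graph 0 (\<lambda>\<Lambda>. b \<Lambda> - b' \<Lambda>)" using graph_diff[OF assms] by simp
  show ?thesis
  proof
    fix \<Lambda>
    show "b \<Lambda> = b' \<Lambda>" using fun_cong[OF graph_zero_left[OF diff], of \<Lambda>] by simp
  qed
qed

text \<open>
  The vectors related to the zero function form a submodule, which is proper as it does not contain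
  \<open>v0\<close>.
\<close>

lemma graph_zero_right:
  assumes "graph a (\<lambda>_. 0)"
  shows "a = 0"
proof -
  let ?W = "{a. graph a (\<lambda>_. 0)}"
  have "subspace ?W"
    unfolding subspace_def using graph_zero graph_add[of _ "\<lambda>_. 0" _ "\<lambda>_. 0"] graph_scale[of _ "\<lambda>_. 0"]
    by auto
  moreover have "E k (\<lambda>_. 0) = (\<lambda>_. 0)" "F k (\<lambda>_. 0) = (\<lambda>_. 0)" "gt.diag k (\<lambda>_. 0) = (\<lambda>_. 0)" for k
    by (auto simp: gt.raise_def gt.lower_def gt.diag_def)
  ultimately have "submodule ?W"
    using graph_e[of _ "\<lambda>_. 0"] graph_f[of _ "\<lambda>_. 0"] graph_h[of _ "\<lambda>_. 0"]
    by (intro submodule_if_Chevalley_closed) auto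
  from simple[OF this] show ?thesis
  proof
    assume "?W = UNIV"
    then have "graph v0 (\<lambda>_. 0)" by blast
    from fun_cong[OF graph_unique_right[OF this graph_top], of gt.top_pattern]
    show ?thesis by (simp add: gt.top_vec_def)
  qed (use assms in auto)
qed

lemma graph_total: "\<exists>b. graph a b"
proof -
  let ?W = "{a. \<exists>b. graph a b}"
  have "subspace ?W"
    unfolding subspace_def using graph_zero graph_add graph_scale by blast
  then have "submodule ?W"
    using graph_e graph_f graph_h by (intro submodule_if_Chevalley_closed) blast+
  from simple[OF this] show ?thesis using graph_top v0_nonzero by blast
qed

text \<open>
  Otherwise the image would have a nonzero annihilator.  The annihilator is stable under the transposed
  lowering operators, which are raising operators with nonzero coefficients, so it would contain a
  multiple of \<open>top_vec\<close>; but \<open>top_vec\<close> is in the image and not orthogonal to itself.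
\<close>

lemma graph_onto:
  assumes g: "gt.supported g"
  shows "\<exists>a. graph a g"
proof -
  let ?S = "{b. \<exists>a. graph a b}"
  have "\<exists>b\<in>?S. \<forall>\<Lambda>\<in>gt.P. b \<Lambda> = g \<Lambda>"
  proof (rule annihilator_trivial_imp_all[OF gt.finite_P])
    fix c assume c: "\<And>b. b \<in> ?S \<Longrightarrow> (\<Sum>\<Lambda>\<in>gt.P. c \<Lambda> * b \<Lambda>) = 0"
    define c' where "c' \<Lambda> = (if \<Lambda> \<in> gt.P then c \<Lambda> else 0)" for \<Lambda>
    \<comment> \<open>The annihilator of the image.\<close>
    let ?K = "{c. gt.supported c \<and> (\<forall>a b. graph a b \<longrightarrow> (\<Sum>\<Lambda>\<in>gt.P. c \<Lambda> * b \<Lambda>) = 0)}"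
    have c'K: "c' \<in> ?K" using c by (auto simp: c'_def gt.supported_def)
    have closed: "gt.raise down_coef k c \<in> ?K" if "c \<in> ?K" "Suc k < n" for c k
    proof (intro CollectI conjI allI impI gt.supported_raise)
      fix a b assume ab: "graph a b"
      have "(\<Sum>\<Lambda>\<in>gt.P. gt.raise down_coef k c \<Lambda> * b \<Lambda>) = (\<Sum>\<Lambda>\<in>gt.P. c \<Lambda> * F k b \<Lambda>)"
        using that graph_supported[OF ab] by (subst gt.sum_mult_lower) auto
      also have "\<dots> = 0" using that graph_f[OF ab that(2)] by blast
      finally show "(\<Sum>\<Lambda>\<in>gt.P. gt.raise down_coef k c \<Lambda> * b \<Lambda>) = 0" .
    qed
    have "c' = (\<lambda>_. 0)"
    proof (rule ccontr)
      assume "c' \<noteq> (\<lambda>_. 0)"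
      with gt.top_supported_vector_exists[of down_coef ?K c'] gt.down_coef_nonzero closed c'K
      obtain z where z: "z \<noteq> 0" "(\<lambda>\<Lambda>. z * gt.top_vec \<Lambda>) \<in> ?K" by blast
      then have "(\<Sum>\<Lambda>\<in>gt.P. z * gt.top_vec \<Lambda> * gt.top_vec \<Lambda>) = 0" using graph_top by blast
      moreover have "(\<Sum>\<Lambda>\<in>gt.P. z * gt.top_vec \<Lambda> * gt.top_vec \<Lambda>) =
        (\<Sum>\<Lambda>\<in>gt.P. if \<Lambda> = gt.top_pattern then z else 0)"
        by (intro sum.cong) (auto simp: gt.top_vec_def)
      ultimately show False using z(1) gt.finite_P gt.top_pattern_in_P by simp
    qed
    then show "\<forall>\<Lambda>\<in>gt.P. c \<Lambda> = 0" unfolding c'_def by (metis (no_types))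
  qed (use graph_add graph_scale graph_zero in blast)+
  then obtain a b where ab: "graph a b" "\<forall>\<Lambda>\<in>gt.P. b \<Lambda> = g \<Lambda>" by blast
  then have "b = g"
    using graph_supported[OF ab(1)] g unfolding gt.supported_def by (metis ext)
  then show ?thesis using ab by blast
qed

text \<open>
  The vectors related to the indicator functions of the single patterns form a basis.
\<close>

theorem dim_eq_card_gt_patterns:
  "dim UNIV = card (gt_patterns n (\<lambda>i. int (\<pi> (n - Suc i)) + int i))"
proof -
  define \<delta> :: "(nat \<times> nat \<Rightarrow> int) \<Rightarrow> (nat \<times> nat \<Rightarrow> int) \<Rightarrow> complex"
    where "\<delta> \<Lambda> M = (if M = \<Lambda> then 1 else 0)" for \<Lambda> M
  have "\<exists>a. graph a (\<delta> \<Lambda>)" if "\<Lambda> \<in> gt.P" for \<Lambda>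
    using that by (intro graph_onto) (auto simp: gt.supported_def \<delta>_def)
  then obtain u where u: "graph (u \<Lambda>) (\<delta> \<Lambda>)" if "\<Lambda> \<in> gt.P" for \<Lambda> by metis
  have comb: "graph (\<Sum>\<Lambda>\<in>gt.P. scale (c \<Lambda>) (u \<Lambda>)) (\<lambda>M. if M \<in> gt.P then c M else 0)" for c
  proof -
    have "graph (\<Sum>\<Lambda>\<in>gt.P. scale (c \<Lambda>) (u \<Lambda>)) (\<lambda>M. \<Sum>\<Lambda>\<in>gt.P. c \<Lambda> * \<delta> \<Lambda> M)"
      by (intro graph_sum gt.finite_P graph_scale u)
    moreover have "(\<Sum>\<Lambda>\<in>gt.P. c \<Lambda> * \<delta> \<Lambda> M) = (\<Sum>\<Lambda>\<in>gt.P. if M = \<Lambda> then c M else 0)" for M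
      by (intro sum.cong) (auto simp: \<delta>_def)
    ultimately show ?thesis using gt.finite_P by simp
  qed
  have inj: "inj_on u gt.P"
  proof (rule inj_onI)
    fix \<Lambda> M assume "\<Lambda> \<in> gt.P" "M \<in> gt.P" "u \<Lambda> = u M"
    then have "\<delta> \<Lambda> = \<delta> M" using graph_unique_right[of "u \<Lambda>" "\<delta> \<Lambda>" "\<delta> M"] u by metis
    from fun_cong[OF this, of \<Lambda>] show "\<Lambda> = M" by (simp add: \<delta>_def split: if_splits)
  qed
  show ?thesis
  proof (rule dim_unique[of "u ` gt.P"])
    show "UNIV \<subseteq> span (u ` gt.P)"
    proof
      fix a
      obtain b where b: "graph a b" using graph_total by blast
      have "(\<lambda>M. b M - (if M \<in> gt.P then b M else 0)) = (\<lambda>_. 0)"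
        using graph_supported[OF b] by (auto simp: gt.supported_def)
      then have "graph (a - (\<Sum>\<Lambda>\<in>gt.P. scale (b \<Lambda>) (u \<Lambda>))) (\<lambda>_. 0)"
        using graph_diff[OF b comb[of b]] by (simp only:)
      then have eq: "a = (\<Sum>\<Lambda>\<in>gt.P. scale (b \<Lambda>) (u \<Lambda>))" using graph_zero_right by fastforce
      have "(\<Sum>\<Lambda>\<in>gt.P. scale (b \<Lambda>) (u \<Lambda>)) \<in> span (u ` gt.P)"
        by (intro span_sum span_scale span_base imageI)
      then show "a \<in> span (u ` gt.P)" by (subst eq)
    qed
    show "independent (u ` gt.P)"
    proof (rule independent_if_scalars_zero)
      fix c w assume sum: "(\<Sum>w\<in>u ` gt.P. scale (c w) w) = 0" and w: "w \<in> u ` gt.P"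
      obtain \<Lambda> where \<Lambda>: "\<Lambda> \<in> gt.P" "w = u \<Lambda>" using w by auto
      have "(\<Sum>\<Lambda>\<in>gt.P. scale (c (u \<Lambda>)) (u \<Lambda>)) = 0" using sum by (simp add: sum.reindex[OF inj])
      with comb[of "\<lambda>\<Lambda>. c (u \<Lambda>)"] have "graph 0 (\<lambda>M. if M \<in> gt.P then c (u M) else 0)" by simp
      from fun_cong[OF graph_zero_left[OF this], of \<Lambda>] show "c w = 0" using \<Lambda> by simp
    qed (use gt.finite_P in auto)
    show "card (u ` gt.P) = card gt.P" by (rule card_image[OF inj])
  qed simp
qed

end

text \<open>
  The coordinates \<open>\<pi> (n - Suc i) + i\<close> are the parts in increasing order, separated by \<open>i\<close>
  so as to be strictly increasing.
\<close>

lemma dim_is_F: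
  fixes scale :: "complex \<Rightarrow> 'v::ab_group_add \<Rightarrow> 'v"
  assumes F: "is_F n \<pi> scale act" and \<pi>: "antimono \<pi>"
  shows "vector_space.dim scale UNIV = card (gt_patterns n (\<lambda>i. int (\<pi> (n - Suc i)) + int i))"
proof -
  interpret fd_simple_gl_module scale n act using F by (simp add: is_F_def)
  obtain v where "v \<noteq> 0" "\<And>i j. i < j \<Longrightarrow> j < n \<Longrightarrow> act (matrix_unit n i j) v = 0"
    "\<And>i. i < n \<Longrightarrow> act (matrix_unit n i i) v = scale (of_nat (\<pi> i)) v"
    using F unfolding is_F_def has_highest_weight_def by blast
  then interpret fd_simple_gl_module_highest_weight scale n act \<pi> v
    using \<pi> by unfold_locales (auto intro: antimonoD)
  show ?thesis by (rule dim_eq_card_gt_patterns)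
qed

section \<open>Differences inside a set and its complement\<close>

definition vandermonde :: "nat set \<Rightarrow> real" where
  "vandermonde X = (\<Prod>v\<in>X. \<Prod>u\<in>{u\<in>X. u < v}. real v - real u)"

lemma vandermonde_insert:
  assumes "finite X" "b \<notin> X"
  shows "vandermonde (insert b X) = vandermonde X * (\<Prod>c\<in>X. \<bar>real b - real c\<bar>)"
proof -
  have b: "{u \<in> insert b X. u < b} = {u\<in>X. u < b}" by auto
  have v: "(\<Prod>u\<in>{u \<in> insert b X. u < v}. real v - real u) =
      (\<Prod>u\<in>{u\<in>X. u < v}. real v - real u) * (if b < v then real v - real b else 1)" for v
  proof (cases "b < v")
    case True
    then have "{u \<in> insert b X. u < v} = insert b {u\<in>X. u < v}" by auto
    then show ?thesis using assms True by simp
  next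
    case False
    then have "{u \<in> insert b X. u < v} = {u\<in>X. u < v}" by auto
    then show ?thesis using False by simp
  qed
  have "vandermonde (insert b X) =
      (\<Prod>u\<in>{u\<in>X. u < b}. real b - real u) * (vandermonde X * (\<Prod>v\<in>X. if b < v then real v - real b else 1))"
    unfolding vandermonde_def by (simp only: prod.insert[OF assms] v b prod.distrib less_irrefl if_False mult_1_left mult.assoc)
  also have "(\<Prod>u\<in>{u\<in>X. u < b}. real b - real u) = (\<Prod>u\<in>X. if u < b then real b - real u else 1)"
    using assms(1) by (simp add: prod.If_cases Int_def)
  also have "\<dots> * (vandermonde X * (\<Prod>v\<in>X. if b < v then real v - real b else 1)) =
      vandermonde X * (\<Prod>c\<in>X. (if c < b then real b - real c else 1) * (if b < c then real c - real b else 1))"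
    by (simp add: prod.distrib)
  also have "(\<Prod>c\<in>X. (if c < b then real b - real c else 1) * (if b < c then real c - real b else 1)) =
      (\<Prod>c\<in>X. \<bar>real b - real c\<bar>)"
    using assms(2) by (intro prod.cong) (auto simp: not_less le_less)
  finally show ?thesis .
qed

lemma vandermonde_empty [simp]: "vandermonde {} = 1"
  by (simp add: vandermonde_def)

text \<open>
  The product depends only on the distances, so it is invariant under translations and reflections.
\<close>

lemma vandermonde_image:
  assumes "finite X" and "\<And>u v. u \<in> X \<Longrightarrow> v \<in> X \<Longrightarrow> \<bar>real (f u) - real (f v)\<bar> = \<bar>real u - real v\<bar>"
  shows "vandermonde (f ` X) = vandermonde X"
  using assms
proof (induction X rule: finite_induct)
  case (insert b X)
  have inj: "inj_on f (insert b X)"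
  proof (rule inj_onI)
    fix u v assume "u \<in> insert b X" "v \<in> insert b X" "f u = f v"
    then show "u = v" using insert.prems[of u v] by simp
  qed
  then have "f b \<notin> f ` X" "inj_on f X" using insert.hyps by (auto simp: inj_on_def)
  then have "vandermonde (f ` insert b X) = vandermonde (f ` X) * (\<Prod>c\<in>X. \<bar>real (f b) - real (f c)\<bar>)"
    using insert.hyps by (simp add: vandermonde_insert prod.reindex)
  also have "\<dots> = vandermonde (insert b X)"
    using insert by (simp add: vandermonde_insert)
  finally show ?case .
qed simp

lemma vandermonde_union:
  assumes "finite X" "finite Y" "\<And>u v. u \<in> X \<Longrightarrow> v \<in> Y \<Longrightarrow> u < v"
  shows "vandermonde (X \<union> Y) = vandermonde X * vandermonde Y * (\<Prod>v\<in>Y. \<Prod>u\<in>X. real v - real u)"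
  using assms(2,3)
proof (induction Y rule: finite_induct)
  case (insert b Y)
  have "b \<notin> X \<union> Y" using insert.hyps insert.prems[of b b] by auto
  moreover have "X \<inter> Y = {}" using insert.prems by fastforce
  ultimately have "vandermonde (X \<union> insert b Y) =
      vandermonde (X \<union> Y) * ((\<Prod>c\<in>X. \<bar>real b - real c\<bar>) * (\<Prod>c\<in>Y. \<bar>real b - real c\<bar>))"
    using assms(1) insert.hyps by (simp add: vandermonde_insert prod.union_disjoint)
  also have "(\<Prod>c\<in>X. \<bar>real b - real c\<bar>) = (\<Prod>c\<in>X. real b - real c)"
    using insert.prems by (intro prod.cong) (auto intro!: abs_of_nonneg less_imp_le)
  finally show ?case
    using insert by (simp add: vandermonde_insert ac_simps)
qed simp

lemma vandermonde_lessThan: "vandermonde {..<n} = (\<Prod>j<n. fact j)"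
proof (induction n)
  case (Suc n)
  have "(\<Prod>c<n. \<bar>real n - real c\<bar>) = (\<Prod>c<n. real (Suc c))"
    by (rule prod.reindex_bij_witness[of _ "\<lambda>c. n - Suc c" "\<lambda>c. n - Suc c"]) (auto simp: of_nat_diff)
  also have "\<dots> = fact n" by (simp add: fact_prod_Suc atLeast0LessThan)
  finally show ?case
    using Suc by (simp add: lessThan_Suc vandermonde_insert)
qed simp

lemma vandermonde_pos: "finite X \<Longrightarrow> vandermonde X > 0"
  by (auto simp: vandermonde_def intro!: prod_pos)

lemma prod_dist_lessThan:
  assumes "b < n"
  shows "(\<Prod>c\<in>{..<n} - {b}. \<bar>real b - real c\<bar>) = fact b * fact (n - Suc b)"
proof -
  have parts: "{..<n} - {b} = {..<b} \<union> {Suc b..<n}" using assms by auto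
  have "(\<Prod>c\<in>{..<n} - {b}. \<bar>real b - real c\<bar>) =
      (\<Prod>c<b. \<bar>real b - real c\<bar>) * (\<Prod>c\<in>{Suc b..<n}. \<bar>real b - real c\<bar>)"
    unfolding parts by (rule prod.union_disjoint) auto
  also have "(\<Prod>c<b. \<bar>real b - real c\<bar>) = (\<Prod>c<b. real (Suc c))"
    by (rule prod.reindex_bij_witness[of _ "\<lambda>c. b - Suc c" "\<lambda>c. b - Suc c"]) (auto simp: of_nat_diff)
  also have "(\<Prod>c\<in>{Suc b..<n}. \<bar>real b - real c\<bar>) = (\<Prod>c<n - Suc b. real (Suc c))"
    by (rule prod.reindex_bij_witness[of _ "\<lambda>c. c + Suc b" "\<lambda>c. c - Suc b"]) (auto simp: of_nat_diff)
  finally show ?thesis by (simp add: fact_prod_Suc atLeast0LessThan)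
qed

text \<open>
  Moving one element \<open>b\<close> from the complement to \<open>B\<close> multiplies \<open>vandermonde B\<close> by its
  distances to the old \<open>B\<close> and divides \<open>vandermonde ({..<n} - B)\<close> by its distances to the new
  complement.  Together these are the distances of \<open>b\<close> to all other elements of \<open>{..<n}\<close>, with
  product \<open>fact b * fact (n - Suc b)\<close>.
\<close>

lemma vandermonde_complement:
  assumes "finite B" "B \<subseteq> {..<n}"
  shows "vandermonde ({..<n} - B) * (\<Prod>b\<in>B. fact b * fact (n - Suc b)) =
    vandermonde {..<n} * vandermonde B"
  using assms
proof (induction B rule: finite_induct)
  case (insert b B)
  let ?C = "{..<n} - insert b B" and ?d = "\<lambda>c. \<bar>real b - real c\<bar>"
  have b: "b < n" "b \<notin> B" using insert by auto
  have "insert b ?C = {..<n} - B" using b by auto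
  then have 1: "vandermonde ({..<n} - B) = vandermonde ?C * (\<Prod>c\<in>?C. ?d c)"
    using vandermonde_insert[of ?C b] by simp
  have "{..<n} - {b} = ?C \<union> B" using insert by auto
  moreover have "?C \<inter> B = {}" by auto
  ultimately have 2: "fact b * fact (n - Suc b) = (\<Prod>c\<in>?C. ?d c) * (\<Prod>c\<in>B. ?d c)"
    using prod_dist_lessThan[OF b(1)] insert.hyps by (simp add: prod.union_disjoint)
  have nz: "(\<Prod>c\<in>?C. ?d c) \<noteq> 0" using b by (auto simp: prod_zero_iff)
  have "(\<Prod>c\<in>?C. ?d c) * (vandermonde ?C * (\<Prod>b\<in>insert b B. fact b * fact (n - Suc b))) =
    (\<Prod>c\<in>?C. ?d c) * (vandermonde {..<n} * vandermonde (insert b B))"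
    using insert 1 2 b(2) by (simp add: vandermonde_insert algebra_simps)
  then show ?case by (rule iffD1[OF mult_left_cancel[OF nz]])
qed simp

lemma card_gt_patterns_vandermonde:
  fixes x :: "nat \<Rightarrow> nat"
  assumes "\<And>i. Suc i < n \<Longrightarrow> x i < x (Suc i)"
  shows "real (card (gt_patterns n (\<lambda>i. int (x i)))) * vandermonde {..<n} = vandermonde (x ` {..<n})"
proof -
  have mono: "strict_mono_on {..<n} x" using strict_mono_onI_Suc[of n x] assms by blast
  then have inj: "inj_on x {..<n}" by (rule strict_mono_on_imp_inj_on)
  have "vandermonde (x ` {..<n}) = (\<Prod>j<n. \<Prod>u\<in>{u \<in> x ` {..<n}. u < x j}. real (x j) - real u)"
    unfolding vandermonde_def by (simp add: prod.reindex[OF inj])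
  also have "\<dots> = (\<Prod>j<n. \<Prod>i<j. real (x j) - real (x i))"
  proof (rule prod.cong[OF refl])
    fix j assume j: "j \<in> {..<n}"
    have "{u \<in> x ` {..<n}. u < x j} = x ` {..<j}"
      using j strict_mono_on_less[OF mono] by auto
    moreover have "inj_on x {..<j}" using inj j by (auto simp: inj_on_def)
    ultimately show "(\<Prod>u\<in>{u \<in> x ` {..<n}. u < x j}. real (x j) - real u) = (\<Prod>i<j. real (x j) - real (x i))"
      by (simp add: prod.reindex)
  qed
  finally show ?thesis
    using card_gt_patterns[of n "\<lambda>i. int (x i)"] assms
    by (simp add: vandermonde_lessThan prod_dividef)
qed

section \<open>The dimension in Frobenius coordinates\<close>

lemma frob_props:
  assumes "sorted_wrt (>) \<alpha>" "sorted_wrt (>) \<beta>" "length \<alpha> = length \<beta>"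
  shows "is_partition (frob \<alpha> \<beta>)"
    and "i < length \<alpha> \<Longrightarrow> frob \<alpha> \<beta> i = \<alpha> ! i + Suc i"
    and "i < length \<alpha> \<Longrightarrow> conj_part (frob \<alpha> \<beta>) i = \<beta> ! i + Suc i"
    and "length \<alpha> \<le> i \<Longrightarrow> frob \<alpha> \<beta> i \<le> length \<alpha>"
proof -
  let ?l = "frob \<alpha> \<beta>"
  have l: "is_partition ?l" "frob_coords ?l = (\<alpha>, \<beta>)"
    using theI'[OF ex1_frob_coords[OF assms]] by (auto simp: frob_def)
  show "is_partition ?l" by (fact l(1))
  have coords: "\<alpha> = map (\<lambda>i. ?l i - Suc i) [0..<frob_rank ?l]"
    "\<beta> = map (\<lambda>i. conj_part ?l i - Suc i) [0..<frob_rank ?l]"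
    using l(2) by (auto simp: frob_coords_def)
  then have r: "frob_rank ?l = length \<alpha>" by (metis length_map length_upt minus_nat.diff_0)
  note bounds = frob_rank_bounds[OF l(1), unfolded r]
  show 1: "?l i = \<alpha> ! i + Suc i" if "i < length \<alpha>" for i
    using bounds(1)[OF that] that arg_cong[OF coords(1), of "\<lambda>xs. xs ! i"] by (simp add: r)
  show "conj_part ?l i = \<beta> ! i + Suc i" if "i < length \<alpha>"
    using less_conj_part_iff[OF l(1), of i i] 1[OF that] that
      arg_cong[OF coords(2), of "\<lambda>xs. xs ! i"] by (simp add: r)
  show "?l i \<le> length \<alpha>" if "length \<alpha> \<le> i"
    using l(1) bounds(2) antimonoD[of ?l "length \<alpha>" i] that by (auto simp: is_partition_def)
qed

lemma distinct_if_sorted_wrt_greater: "sorted_wrt (>) xs \<Longrightarrow> distinct xs" for xs :: "nat list"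
  by (induction xs) auto

text \<open>
  The rows with index less than the Frobenius rank give the elements \<open>\<alpha>\<^sub>i + n\<close>.  For the other rows the
  claim is that \<open>i - \<lambda>\<^sub>i\<close> is never a value \<open>\<beta>\<^sub>j = \<lambda>'\<^sub>j - j - 1\<close>: otherwise
  \<open>\<lambda>\<^sub>i + \<lambda>'\<^sub>j = i + j + 1\<close>, but the sum is at least \<open>i + j + 2\<close> if the cell \<open>(i, j)\<close>
  is in the diagram and at most \<open>i + j\<close> if not.  Counting shows that all elements are reached.
\<close>

lemma frob_beta_set:
  assumes ab: "sorted_wrt (>) \<alpha>" "sorted_wrt (>) \<beta>" "length \<alpha> = length \<beta>"
    and n: "set \<beta> \<subseteq> {..<n}"
  shows "(\<lambda>i. frob \<alpha> \<beta> (n - Suc i) + i) ` {..<n} =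
    (\<lambda>b. n - Suc b) ` ({..<n} - set \<beta>) \<union> (\<lambda>a. a + n) ` set \<alpha>"
    (is "?X = ?Y")
proof (rule card_subset_eq)
  let ?l = "frob \<alpha> \<beta>" and ?r = "length \<alpha>"
  note l = frob_props[OF ab]
  have dist: "distinct \<alpha>" "distinct \<beta>" using ab by (auto intro: distinct_if_sorted_wrt_greater)
  have anti: "?l j \<le> ?l i" if "i \<le> j" for i j
    using l(1) that by (auto simp: is_partition_def antimonoD)
  show "finite ?Y" by simp
  show "?X \<subseteq> ?Y"
  proof
    fix u assume "u \<in> ?X"
    then obtain k where k: "k < n" "u = ?l (n - Suc k) + k" by auto
    define i where "i = n - Suc k"
    have i: "i < n" "k = n - Suc i" "u = ?l i + (n - Suc i)" using k by (auto simp: i_def)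
    show "u \<in> ?Y"
    proof (cases "i < ?r")
      case True
      then have "u = \<alpha> ! i + n" using l(2)[OF True] i by simp
      then show ?thesis using True by simp
    next
      case False
      then have li: "?l i \<le> i" using l(4)[of i] by simp
      have "i - ?l i \<notin> set \<beta>"
      proof
        assume "i - ?l i \<in> set \<beta>"
        then obtain j where j: "j < ?r" "\<beta> ! j = i - ?l i" using ab(3) by (auto simp: in_set_conv_nth)
        show False
          using l(3)[OF j(1)] j(2) less_conj_part_iff[OF l(1), of i j] li by linarith
      qed
      moreover have "u = n - Suc (i - ?l i)" using i li by simp
      ultimately show ?thesis using i(1) by (intro UnI1 image_eqI[of _ _ "i - ?l i"]) auto
    qed
  qed
  have "strict_mono_on {..<n} (\<lambda>i. ?l (n - Suc i) + i)"
  proof (rule strict_mono_onI_Suc)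
    fix i assume "Suc i < n"
    then show "?l (n - Suc i) + i < ?l (n - Suc (Suc i)) + Suc i"
      using anti[of "n - Suc (Suc i)" "n - Suc i"] by (simp add: less_Suc_eq_le diff_le_mono2)
  qed
  then have "card ?X = n" by (simp add: card_image strict_mono_on_imp_inj_on)
  moreover have "card ?Y = card ((\<lambda>b. n - Suc b) ` ({..<n} - set \<beta>)) + card ((\<lambda>a. a + n) ` set \<alpha>)"
    by (rule card_Un_disjoint) auto
  moreover have "card ((\<lambda>b. n - Suc b) ` ({..<n} - set \<beta>)) = n - ?r"
    using n dist ab(3) by (subst card_image) (auto simp: inj_on_def card_Diff_subset distinct_card)
  moreover have "card ((\<lambda>a. a + n) ` set \<alpha>) = ?r"
    using dist by (subst card_image) (auto simp: distinct_card)
  moreover have "?r \<le> n"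
    using card_mono[OF _ n] dist ab(3) by (simp add: distinct_card)
  ultimately show "card ?X = card ?Y" by simp
qed

text \<open>
  Split the product of differences of \<open>n + \<alpha>\<close> and the reflected complement of \<open>\<beta>\<close> into the
  differences inside the two sets and the mixed ones.  A mixed difference is \<open>a + b + 1\<close> with \<open>b\<close>
  outside \<open>\<beta>\<close>; including the \<open>b\<close> in \<open>\<beta>\<close> completes the product for fixed \<open>a\<close> to a
  quotient of factorials.
\<close>

lemma card_gt_patterns_frob:
  assumes ab: "sorted_wrt (>) \<alpha>" "sorted_wrt (>) \<beta>" "length \<alpha> = length \<beta>"
    and n: "set \<beta> \<subseteq> {..<n}"
  shows "real (card (gt_patterns n (\<lambda>i. int (frob \<alpha> \<beta> (n - Suc i)) + int i))) *
    ((\<Prod>a\<in>set \<alpha>. \<Prod>b\<in>set \<beta>. real (a + b + 1)) * (\<Prod>a\<in>set \<alpha>. fact a) *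
      (\<Prod>b\<in>set \<beta>. fact b * fact (n - Suc b))) =
    vandermonde (set \<alpha>) * vandermonde (set \<beta>) * (\<Prod>a\<in>set \<alpha>. fact (a + n))"
proof -
  let ?A = "set \<alpha>" and ?B = "set \<beta>"
  let ?C = "{..<n} - ?B"
  let ?x = "\<lambda>i. frob \<alpha> \<beta> (n - Suc i) + i"
  let ?V = "vandermonde {..<n}"
  let ?N = "real (card (gt_patterns n (\<lambda>i. int (?x i))))"
  let ?\<Phi> = "\<Prod>b\<in>?B. fact b * fact (n - Suc b) :: real"
  have anti: "frob \<alpha> \<beta> j \<le> frob \<alpha> \<beta> i" if "i \<le> j" for i j
    using frob_props(1)[OF ab] that by (auto simp: is_partition_def antimonoD)
  have "?N * ?V = vandermonde (?x ` {..<n})"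
  proof (rule card_gt_patterns_vandermonde)
    fix i assume "Suc i < n"
    then show "?x i < ?x (Suc i)" using anti[of "n - Suc (Suc i)" "n - Suc i"] by (simp add: less_Suc_eq_le diff_le_mono2)
  qed
  also have "?x ` {..<n} = (\<lambda>b. n - Suc b) ` ?C \<union> (\<lambda>a. a + n) ` ?A"
    by (rule frob_beta_set[OF ab n])
  also have "vandermonde \<dots> = vandermonde ((\<lambda>b. n - Suc b) ` ?C) * vandermonde ((\<lambda>a. a + n) ` ?A) *
      (\<Prod>v\<in>(\<lambda>a. a + n) ` ?A. \<Prod>u\<in>(\<lambda>b. n - Suc b) ` ?C. real v - real u)"
    by (rule vandermonde_union) auto
  also have "vandermonde ((\<lambda>b. n - Suc b) ` ?C) = vandermonde ?C"
    by (rule vandermonde_image) (auto simp: of_nat_diff)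
  also have "vandermonde ((\<lambda>a. a + n) ` ?A) = vandermonde ?A"
    by (rule vandermonde_image) auto
  also have "(\<Prod>v\<in>(\<lambda>a. a + n) ` ?A. \<Prod>u\<in>(\<lambda>b. n - Suc b) ` ?C. real v - real u) =
      (\<Prod>a\<in>?A. \<Prod>b\<in>?C. real (a + n) - real (n - Suc b))"
  proof -
    have "inj_on (\<lambda>b. n - Suc b) ?C" "inj_on (\<lambda>a. a + n) ?A" by (auto simp: inj_on_def)
    then show ?thesis by (simp only: prod.reindex o_def)
  qed
  also have "\<dots> = (\<Prod>a\<in>?A. \<Prod>b\<in>?C. real (a + b + 1))"
    by (intro prod.cong refl) (auto simp: of_nat_diff)
  finally have 1: "?N * ?V = vandermonde ?C * vandermonde ?A * (\<Prod>a\<in>?A. \<Prod>b\<in>?C. real (a + b + 1))" .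
  have hook: "(\<Prod>b\<in>?B. real (a + b + 1)) * (\<Prod>b\<in>?C. real (a + b + 1)) * fact a = fact (a + n)" for a
  proof -
    have "(\<Prod>b<k. real (a + b + 1)) * fact a = fact (a + k)" for k
    proof (induction k)
      case (Suc k)
      have "(\<Prod>b<Suc k. real (a + b + 1)) * fact a = real (a + k + 1) * ((\<Prod>b<k. real (a + b + 1)) * fact a)"
        by (simp only: prod.lessThan_Suc ac_simps)
      then show ?case by (simp only: Suc.IH) simp
    qed simp
    from this[of n] show ?thesis by (simp only: prod.subset_diff[OF n finite_lessThan] ac_simps)
  qed
  have "(\<Prod>a\<in>?A. \<Prod>b\<in>?B. real (a + b + 1)) * (\<Prod>a\<in>?A. \<Prod>b\<in>?C. real (a + b + 1)) * (\<Prod>a\<in>?A. fact a) =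
      (\<Prod>a\<in>?A. fact (a + n))"
    unfolding prod.distrib[symmetric] by (intro prod.cong refl hook)
  moreover have "vandermonde ?C * ?\<Phi> = ?V * vandermonde ?B"
    using vandermonde_complement[OF _ n] by simp
  ultimately have "?V * (vandermonde ?A * vandermonde ?B * (\<Prod>a\<in>?A. fact (a + n))) =
      (vandermonde ?C * ?\<Phi>) * vandermonde ?A * ((\<Prod>a\<in>?A. \<Prod>b\<in>?B. real (a + b + 1)) *
        (\<Prod>a\<in>?A. \<Prod>b\<in>?C. real (a + b + 1)) * (\<Prod>a\<in>?A. fact a))"
    by (simp only: ac_simps)
  also have "\<dots> = (vandermonde ?C * vandermonde ?A * (\<Prod>a\<in>?A. \<Prod>b\<in>?C. real (a + b + 1))) *
      ((\<Prod>a\<in>?A. \<Prod>b\<in>?B. real (a + b + 1)) * (\<Prod>a\<in>?A. fact a) * ?\<Phi>)"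
    by (simp only: ac_simps)
  also have "\<dots> = ?V * (?N * ((\<Prod>a\<in>?A. \<Prod>b\<in>?B. real (a + b + 1)) * (\<Prod>a\<in>?A. fact a) * ?\<Phi>))"
    unfolding 1[symmetric] by (simp only: ac_simps)
  finally have eq: "?V * (?N * ((\<Prod>a\<in>?A. \<Prod>b\<in>?B. real (a + b + 1)) * (\<Prod>a\<in>?A. fact a) * ?\<Phi>)) =
    ?V * (vandermonde ?A * vandermonde ?B * (\<Prod>a\<in>?A. fact (a + n)))" by (rule sym)
  have nz: "?V \<noteq> 0" using vandermonde_pos[of "{..<n}"] by simp
  from eq have "?N * ((\<Prod>a\<in>?A. \<Prod>b\<in>?B. real (a + b + 1)) * (\<Prod>a\<in>?A. fact a) * ?\<Phi>) =
    vandermonde ?A * vandermonde ?B * (\<Prod>a\<in>?A. fact (a + n))"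
    by (rule iffD1[OF mult_left_cancel[OF nz]])
  then show ?thesis by simp
qed

lemma dim_is_F_frob:
  fixes scale :: "complex \<Rightarrow> 'v::ab_group_add \<Rightarrow> 'v"
  assumes ab: "sorted_wrt (>) \<alpha>" "sorted_wrt (>) \<beta>" "length \<alpha> = length \<beta>"
    and n: "set \<beta> \<subseteq> {..<n}" and F: "is_F n (frob \<alpha> \<beta>) scale act"
  shows "real (vector_space.dim scale UNIV) *
    ((\<Prod>a\<in>set \<alpha>. \<Prod>b\<in>set \<beta>. real (a + b + 1)) * (\<Prod>a\<in>set \<alpha>. fact a) *
      (\<Prod>b\<in>set \<beta>. fact b * fact (n - Suc b))) =
    vandermonde (set \<alpha>) * vandermonde (set \<beta>) * (\<Prod>a\<in>set \<alpha>. fact (a + n))"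
proof -
  have "antimono (frob \<alpha> \<beta>)" using frob_props(1)[OF ab] by (simp add: is_partition_def)
  then show ?thesis by (simp only: dim_is_F[OF F] card_gt_patterns_frob[OF ab n])
qed

text \<open>
  The largest entries of \<open>\<beta>\<close> and \<open>\<alpha>\<close> are one less than the length and the first part.
\<close>

lemma frob_bounds:
  assumes ab: "sorted_wrt (>) \<alpha>" "sorted_wrt (>) \<beta>" "length \<alpha> = length \<beta>"
  shows "set \<beta> \<subseteq> {..<part_length (frob \<alpha> \<beta>)}" and "set \<alpha> \<subseteq> {..<frob \<alpha> \<beta> 0}"
proof -
  note l = frob_props[OF ab]
  have head: "x \<le> xs ! 0" if "sorted_wrt (>) xs" "x \<in> set xs" for x :: nat and xs
    using that by (cases xs) auto
  have "part_length (frob \<alpha> \<beta>) = conj_part (frob \<alpha> \<beta>) 0"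
    by (simp add: part_length_def conj_part_def)
  then show "set \<beta> \<subseteq> {..<part_length (frob \<alpha> \<beta>)}"
    using l(3)[of 0] head[OF ab(2)] ab(3) by (cases "\<beta> = []") (auto simp: less_Suc_eq_le)
  show "set \<alpha> \<subseteq> {..<frob \<alpha> \<beta> 0}"
    using l(2)[of 0] head[OF ab(1)] by (cases "\<alpha> = []") (auto simp: less_Suc_eq_le)
qed

section \<open>The dimension identity\<close>

lemma vandermonde_shift: "finite X \<Longrightarrow> vandermonde ((\<lambda>a. a + m) ` X) = vandermonde X"
  by (rule vandermonde_image) auto

lemma prod_shift: "(\<Prod>a\<in>(\<lambda>a. a + m) ` X. g a) = (\<Prod>a\<in>X. g (a + m))"
  for g :: "nat \<Rightarrow> 'a::comm_monoid_mult" and m :: nat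
  by (subst prod.reindex) (auto simp: inj_on_def)

theorem theorem3p8:
  fixes m p q :: nat and \<alpha> \<beta> :: "nat list"
    and scale1 :: "complex \<Rightarrow> 'a::ab_group_add \<Rightarrow> 'a" and act1 :: "complex mat \<Rightarrow> 'a \<Rightarrow> 'a"
    and scale2 :: "complex \<Rightarrow> 'b::ab_group_add \<Rightarrow> 'b" and act2 :: "complex mat \<Rightarrow> 'b \<Rightarrow> 'b"
    and scale3 :: "complex \<Rightarrow> 'c::ab_group_add \<Rightarrow> 'c" and act3 :: "complex mat \<Rightarrow> 'c \<Rightarrow> 'c"
    and scale4 :: "complex \<Rightarrow> 'd::ab_group_add \<Rightarrow> 'd" and act4 :: "complex mat \<Rightarrow> 'd \<Rightarrow> 'd"
  assumes "p \<ge> 1" and "q \<ge> 1"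
    and "sorted_wrt (>) \<alpha>" and "sorted_wrt (>) \<beta>" and "length \<alpha> = length \<beta>"
    and "part_length (frob \<alpha> \<beta>) \<le> p" and "frob \<alpha> \<beta> 0 \<le> q"
    and "is_F p (frob (map (\<lambda>a. a + m) \<alpha>) \<beta>) scale1 act1"
    and "is_F q (frob (map (\<lambda>b. b + m) \<beta>) \<alpha>) scale2 act2"
    and "is_F (p + m) (frob \<alpha> (map (\<lambda>b. b + m) \<beta>)) scale3 act3"
    and "is_F (q + m) (frob \<beta> (map (\<lambda>a. a + m) \<alpha>)) scale4 act4"
  shows "vector_space.dim scale1 UNIV * vector_space.dim scale2 UNIV =
         vector_space.dim scale3 UNIV * vector_space.dim scale4 UNIV"
proof -
  note ab = assms(3-5)
  let ?A = "set \<alpha>" and ?B = "set \<beta>"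
  let ?\<alpha> = "map (\<lambda>a. a + m) \<alpha>" and ?\<beta> = "map (\<lambda>b. b + m) \<beta>"
  have shift: "sorted_wrt (>) ?\<alpha>" "sorted_wrt (>) ?\<beta>"
    using assms(3,4) by (auto simp: sorted_wrt_map)
  have B: "?B \<subseteq> {..<p}" and A: "?A \<subseteq> {..<q}"
    using frob_bounds[OF ab] assms(6,7) by auto
  have Bm: "set ?\<beta> \<subseteq> {..<p + m}" and Am: "set ?\<alpha> \<subseteq> {..<q + m}"
    using A B by auto
  define d1 d2 d3 d4 where
    "d1 = real (vector_space.dim scale1 UNIV)" and "d2 = real (vector_space.dim scale2 UNIV)" and
    "d3 = real (vector_space.dim scale3 UNIV)" and "d4 = real (vector_space.dim scale4 UNIV)"
  \<comment> \<open>All four modules have the same sums \<open>a + b + m + 1\<close>, since each shifts exactly one of the two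
    coordinate sets by \<open>m\<close>.\<close>
  define H where "H = (\<Prod>a\<in>?A. \<Prod>b\<in>?B. real (a + b + m + 1))"
  have H': "H = (\<Prod>b\<in>?B. \<Prod>a\<in>?A. real (b + a + m + 1))"
    unfolding H_def by (subst prod.swap) (simp only: add.commute[of _ "_ :: nat"] ac_simps)
  define V where "V = vandermonde ?A * vandermonde ?B"
  define a0 where "a0 = (\<Prod>a\<in>?A. fact a :: real)"
  define am where "am = (\<Prod>a\<in>?A. fact (a + m) :: real)"
  define aq where "aq = (\<Prod>a\<in>?A. fact (q - Suc a) :: real)"
  define ap where "ap = (\<Prod>a\<in>?A. fact (a + m + p) :: real)"
  define b0 where "b0 = (\<Prod>b\<in>?B. fact b :: real)"
  define bm where "bm = (\<Prod>b\<in>?B. fact (b + m) :: real)"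
  define bp where "bp = (\<Prod>b\<in>?B. fact (p - Suc b) :: real)"
  define bq where "bq = (\<Prod>b\<in>?B. fact (b + m + q) :: real)"
  have e1: "d1 * (H * am * (b0 * bp)) = V * ap"
    using dim_is_F_frob[OF shift(1) ab(2) _ B assms(8)] ab(3)
    by (simp add: d1_def H_def V_def am_def b0_def bp_def ap_def prod_shift vandermonde_shift
        prod.distrib ac_simps)
  have e2: "d2 * (H * bm * (a0 * aq)) = V * bq"
    using dim_is_F_frob[OF shift(2) ab(1) _ A assms(9)] ab(3)
    by (simp add: d2_def H' V_def bm_def a0_def aq_def bq_def prod_shift vandermonde_shift
        prod.distrib ac_simps)
  have e3: "d3 * (H * a0 * (bm * bp)) = V * ap"
    using dim_is_F_frob[OF ab(1) shift(2) _ Bm assms(10)] ab(3)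
    by (simp add: d3_def H_def V_def bm_def a0_def bp_def ap_def prod_shift vandermonde_shift
        prod.distrib ac_simps)
  have e4: "d4 * (H * b0 * (am * aq)) = V * bq"
    using dim_is_F_frob[OF ab(2) shift(1) _ Am assms(11)] ab(3)
    by (simp add: d4_def H' V_def am_def b0_def aq_def bq_def prod_shift vandermonde_shift
        prod.distrib ac_simps)
  have "H > 0" unfolding H_def by (intro prod_pos) auto
  have "a0 > 0" "am > 0" "aq > 0" "b0 > 0" "bm > 0" "bp > 0"
    unfolding a0_def am_def aq_def b0_def bm_def bp_def by (auto intro: prod_pos)
  with \<open>H > 0\<close> have nz: "H * H * a0 * am * aq * b0 * bm * bp \<noteq> 0" by simp
  have "(H * H * a0 * am * aq * b0 * bm * bp) * (d1 * d2) =
      (d1 * (H * am * (b0 * bp))) * (d2 * (H * bm * (a0 * aq)))" by (simp only: ac_simps)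
  also have "\<dots> = (d3 * (H * a0 * (bm * bp))) * (d4 * (H * b0 * (am * aq)))"
    by (simp only: e1 e2 e3 e4)
  also have "\<dots> = (H * H * a0 * am * aq * b0 * bm * bp) * (d3 * d4)" by (simp only: ac_simps)
  finally have "d1 * d2 = d3 * d4" by (rule iffD1[OF mult_left_cancel[OF nz]])
  then show ?thesis unfolding d1_def d2_def d3_def d4_def of_nat_mult[symmetric] of_nat_eq_iff .
qed

end
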